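(* Let $\Omega' = \{27,39,43,91,99,103,127,135,151\}$. For each $v \in \Omega'$ and each integer $t\ge 1$, with $w = 2^t(v+1)-1$, there exists a Steiner triple system $\mathrm{STS}(w)$ for which $\chi \neq \bar\chi$, where $\chi$ and $\bar\chi$ denote its lower and upper chromatic numbers. (So for each $v\in\Omega'$ one obtains an infinite class of such systems.)
   Context: A Steiner triple system of order $v$, $\mathrm{STS}(v)$, is a pair $(V,\mathcal B)$ with $|V|=v$ and $\mathcal B$ a collection of $3$-subsets of $V$ (triples) such that every $2$-subset of $V$ lies in exactly one triple. A (strict) $k$-bicoloring of $(V,\mathcal B)$ is a map from $V$ onto a set of exactly $k$ colors such that every triple receives exactly two distinct colors. The lower chromatic number $\chi$ (upper chromatic number $\bar\chi$) of a bicolorable STS is the minimum (maximum) $k$ for which it has a strict $k$-bicoloring. *)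

theory Defs
  imports Main
begin

definition steiner_triple_system :: "nat \<Rightarrow> 'a set \<Rightarrow> 'a set set \<Rightarrow> bool" where
  "steiner_triple_system v V \<B> \<longleftrightarrow>
     finite V \<and> card V = v \<and>
     (\<forall>T\<in>\<B>. T \<subseteq> V \<and> card T = 3) \<and>
     (\<forall>P. P \<subseteq> V \<and> card P = 2 \<longrightarrow> (\<exists>!T. T \<in> \<B> \<and> P \<subseteq> T))"

(* Colors are natural numbers; this is no restriction, since the color set is finite.
   The values of c outside V are irrelevant. *)
definition strict_bicoloring ::
    "nat \<Rightarrow> 'a set \<Rightarrow> 'a set set \<Rightarrow> ('a \<Rightarrow> nat) \<Rightarrow> bool" where
  "strict_bicoloring k V \<B> c \<longleftrightarrow>
     finite (c ` V) \<and> card (c ` V) = k \<and> (\<forall>T\<in>\<B>. card (c ` T) = 2)"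

definition has_strict_bicoloring :: "nat \<Rightarrow> 'a set \<Rightarrow> 'a set set \<Rightarrow> bool" where
  "has_strict_bicoloring k V \<B> \<longleftrightarrow> (\<exists>c. strict_bicoloring k V \<B> c)"

definition bicolorable :: "'a set \<Rightarrow> 'a set set \<Rightarrow> bool" where
  "bicolorable V \<B> \<longleftrightarrow> (\<exists>k. has_strict_bicoloring k V \<B>)"

(* Both chromatic numbers are meaningful only for bicolorable systems with finite V;
   then k is bounded by card V, so the minimum and the maximum are attained. *)
definition lower_chromatic_number :: "'a set \<Rightarrow> 'a set set \<Rightarrow> nat" where
  "lower_chromatic_number V \<B> = (LEAST k. has_strict_bicoloring k V \<B>)"

definition upper_chromatic_number :: "'a set \<Rightarrow> 'a set set \<Rightarrow> nat" where
  "upper_chromatic_number V \<B> = (GREATEST k. has_strict_bicoloring k V \<B>)"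

end

(* If an STS(v) on V has a 1-factorization of the complete graph on v + 1 new points attached to it,
   the triples {x, a, b} with x in V and ab an edge of the factor of x turn it into an STS(2v + 1).
   Giving all new points one fresh color turns a k-bicoloring into a (k + 1)-bicoloring, so a system
   that admits bicolorings with different numbers of colors passes this property on under doubling.
   To start the process one colors the new points with the old colors instead, which works if
   the 1-factorization is compatible with the coloring. Such pairs of a bicolored STS(v) and a
   compatible 1-factorization are tabulated for v = 13, 19, 21, 25, 31, 33, 37, 45, 49; their doubles
   lie on the orbits 2^t (v + 1) - 1 in question. *)
theory Submission
  imports Defs "HOL-Number_Theory.Cong" "HOL-Library.Code_Binary_Nat"
begin

section \<open>Doubling\<close>

text \<open>Both color numbers must occur on one and the same system, while the doubled system
  depends on the 1-factorization used. A fresh color is compatible with every 1-factorization: a new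
  triple then has two points of that color and one old point. So a 1-factorization that also allows
  the old colors on the new points is needed only once. It gives a single system of order 2v + 1
  with both k and k + 1 colors, and all later doublings can use the circle method. Compatibility is
  a real restriction. In a factor belonging to a point of color i, every new point of color i must
  be joined to a point of another color, and every remaining edge must join points of equal color.
  The class sizes therefore obey exact counting identities, and the starters are given explicitly
  and verified by evaluation.\<close>

lemma steiner_triple_system_iff:
  fixes V :: "nat set"
  shows "steiner_triple_system v V B \<longleftrightarrow>
     finite V \<and> card V = v \<and> (\<forall>T\<in>B. T \<subseteq> V \<and> card T = 3) \<and>
     (\<forall>p\<in>V. \<forall>q\<in>V. p < q \<longrightarrow> (\<exists>!T. T \<in> B \<and> p \<in> T \<and> q \<in> T))"
proof -
  have "(\<forall>P. P \<subseteq> V \<and> card P = 2 \<longrightarrow> (\<exists>!T. T \<in> B \<and> P \<subseteq> T)) \<longleftrightarrow>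
     (\<forall>p\<in>V. \<forall>q\<in>V. p < q \<longrightarrow> (\<exists>!T. T \<in> B \<and> p \<in> T \<and> q \<in> T))" (is "?L \<longleftrightarrow> ?R")
  proof
    assume L: ?L
    show ?R
    proof (intro ballI impI)
      fix p q assume "p \<in> V" "q \<in> V" "p < q"
      with L[rule_format, of "{p, q}"] show "\<exists>!T. T \<in> B \<and> p \<in> T \<and> q \<in> T"
        by simp
    qed
  next
    assume R: ?R
    show ?L
    proof (intro allI impI)
      fix P assume P: "P \<subseteq> V \<and> card P = 2"
      then obtain p q where pq: "P = {p, q}" "p < q"
        by (metis card_2_iff insert_commute linorder_neqE_nat)
      with P R show "\<exists>!T. T \<in> B \<and> P \<subseteq> T" by simp
    qed
  qed
  then show ?thesis
    by (simp add: steiner_triple_system_def)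
qed

section \<open>One-factorizations and doubled triple systems\<close>

definition one_factorization :: "nat \<Rightarrow> (nat \<Rightarrow> nat \<Rightarrow> nat) \<Rightarrow> bool" where
  "one_factorization v f \<longleftrightarrow>
     (\<forall>a\<le>v. \<forall>b\<le>v. f a b = f b a) \<and> (\<forall>a\<le>v. bij_betw (f a) ({..v} - {a}) {..<v})"

text \<open>The old point \<open>f a b\<close> names the factor that contains the edge
  \<open>ab\<close>, and the vertex \<open>a\<close> becomes the point \<open>v + a\<close>. The
  points of the double again form an initial segment of the naturals, so that doubling can be
  iterated.\<close>

definition double :: "nat \<Rightarrow> (nat \<Rightarrow> nat \<Rightarrow> nat) \<Rightarrow> nat set set \<Rightarrow> nat set set" where
  "double v f B = B \<union> {{f a b, v + a, v + b} |a b. a \<le> v \<and> b \<le> v \<and> a \<noteq> b}"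

lemma one_factorizationD:
  assumes "one_factorization v f" "a \<le> v"
  shows "b \<le> v \<Longrightarrow> f a b = f b a"
    and "b \<le> v \<Longrightarrow> b \<noteq> a \<Longrightarrow> f a b < v"
    and "b \<le> v \<Longrightarrow> b' \<le> v \<Longrightarrow> b \<noteq> a \<Longrightarrow> b' \<noteq> a \<Longrightarrow> f a b = f a b' \<Longrightarrow> b = b'"
    and "x < v \<Longrightarrow> \<exists>b\<le>v. b \<noteq> a \<and> f a b = x"
proof -
  have bij: "bij_betw (f a) ({..v} - {a}) {..<v}" and sym: "\<forall>b\<le>v. f a b = f b a"
    using assms by (auto simp: one_factorization_def)
  show "b \<le> v \<Longrightarrow> f a b = f b a" using sym by blast
  show "b \<le> v \<Longrightarrow> b \<noteq> a \<Longrightarrow> f a b < v" using bij_betwE[OF bij] by auto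
  show "b \<le> v \<Longrightarrow> b' \<le> v \<Longrightarrow> b \<noteq> a \<Longrightarrow> b' \<noteq> a \<Longrightarrow> f a b = f a b' \<Longrightarrow> b = b'"
    using bij_betw_imp_inj_on[OF bij] by (auto dest: inj_onD)
  assume "x < v"
  then have "x \<in> f a ` ({..v} - {a})"
    using bij_betw_imp_surj_on[OF bij] by simp
  then show "\<exists>b\<le>v. b \<noteq> a \<and> f a b = x" by auto
qed

text \<open>Two old points lie together in no new triple. An old point \<open>p\<close> and a new
  point \<open>v + b\<close> are completed by the edge of factor \<open>p\<close> at
  \<open>b\<close>, and two new points by the factor that contains their edge.\<close>

lemma steiner_double:
  assumes B: "steiner_triple_system v {..<v} B" and f: "one_factorization v f"
  shows "steiner_triple_system (2 * v + 1) {..<2 * v + 1} (double v f B)"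
  unfolding steiner_triple_system_iff
proof (intro conjI ballI impI)
  have old: "T \<subseteq> {..<v}" if "T \<in> B" for T
    using B that by (simp add: steiner_triple_system_def)
  note fD = one_factorizationD[OF f]
  show "finite {..<2 * v + 1}" "card {..<2 * v + 1} = 2 * v + 1" by simp_all
  show "T \<subseteq> {..<2 * v + 1}" "card T = 3" if T: "T \<in> double v f B" for T
  proof -
    consider "T \<in> B" | a b where "T = {f a b, v + a, v + b}" "a \<le> v" "b \<le> v" "a \<noteq> b"
      using T by (auto simp: double_def)
    then have "T \<subseteq> {..<2 * v + 1} \<and> card T = 3"
    proof cases
      case 1
      then show ?thesis using B old by (fastforce simp: steiner_triple_system_def)
    next
      case 2
      then show ?thesis using fD(2)[of a b] by auto
    qed
    then show "T \<subseteq> {..<2 * v + 1}" "card T = 3" by auto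
  qed
  fix p q assume p: "p \<in> {..<2 * v + 1}" and q: "q \<in> {..<2 * v + 1}" and pq: "p < q"
  \<comment> \<open>As \<open>p < q\<close> and old points precede new ones, a new \<open>p\<close>
    with an old \<open>q\<close> cannot occur.\<close>
  consider "q < v" | b where "p < v" "q = v + b" "b \<le> v"
    | a b where "p = v + a" "q = v + b" "a \<le> v" "b \<le> v" "a < b"
  proof -
    assume *: "q < v \<Longrightarrow> thesis" "\<And>b. p < v \<Longrightarrow> q = v + b \<Longrightarrow> b \<le> v \<Longrightarrow> thesis"
      "\<And>a b. p = v + a \<Longrightarrow> q = v + b \<Longrightarrow> a \<le> v \<Longrightarrow> b \<le> v \<Longrightarrow> a < b \<Longrightarrow> thesis"
    show thesis
      using *(1) *(2)[of "q - v"] *(3)[of "p - v" "q - v"] p q pq by (cases "q < v"; cases "p < v") auto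
  qed
  then show "\<exists>!T. T \<in> double v f B \<and> p \<in> T \<and> q \<in> T"
  proof cases
    case 1
    then have "\<exists>!T. T \<in> B \<and> p \<in> T \<and> q \<in> T"
      using B pq by (simp add: steiner_triple_system_iff)
    moreover have "T \<in> double v f B \<and> p \<in> T \<and> q \<in> T \<longleftrightarrow> T \<in> B \<and> p \<in> T \<and> q \<in> T" for T
    proof -
      \<comment> \<open>Both \<open>p\<close> and \<open>q\<close> lie below \<open>v\<close>, so
        both would have to be the single entry \<open>x\<close>.\<close>
      have False if "p \<in> {x, v + a, v + b}" "q \<in> {x, v + a, v + b}" for x a b
        using that 1 pq by auto
      then show ?thesis by (auto simp: double_def)
    qed
    ultimately show ?thesis by simp
  next
    case 2
    \<comment> \<open>The vertex \<open>a\<close> is the partner of \<open>b\<close> in factor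
      \<open>p\<close>.\<close>
    from fD(4)[of b p] 2 obtain a where a: "a \<le> v" "a \<noteq> b" "f b a = p" by auto
    show ?thesis
    proof (rule ex1I)
      show "{f b a, v + b, v + a} \<in> double v f B \<and> p \<in> {f b a, v + b, v + a} \<and> q \<in> {f b a, v + b, v + a}"
        using a 2 by (auto simp: double_def)
      fix T assume T: "T \<in> double v f B \<and> p \<in> T \<and> q \<in> T"
      with 2 old obtain a' b' where *: "T = {f a' b', v + a', v + b'}" "a' \<le> v" "b' \<le> v" "a' \<noteq> b'"
        by (fastforce simp: double_def)
      with T 2 fD(2)[of a' b'] have "p = f a' b'" "b = a' \<or> b = b'" by auto
      \<comment> \<open>By symmetry the edge can be written with \<open>b\<close> first; injectivity
        of row \<open>b\<close> then identifies the partner.\<close>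
      with * fD(1)[of a' b'] obtain c where "T = {f b c, v + b, v + c}" "c \<le> v" "c \<noteq> b" "f b c = p"
        by auto
      moreover from this have "c = a"
        using fD(3)[of b c a] a 2 by auto
      ultimately show "T = {f b a, v + b, v + a}" by simp
    qed
  next
    case 3
    show ?thesis
    proof (rule ex1I)
      show "{f a b, v + a, v + b} \<in> double v f B \<and> p \<in> {f a b, v + a, v + b} \<and> q \<in> {f a b, v + a, v + b}"
        unfolding double_def using 3 by blast
      fix T assume T: "T \<in> double v f B \<and> p \<in> T \<and> q \<in> T"
      with 3 old obtain a' b' where *: "T = {f a' b', v + a', v + b'}" "a' \<le> v" "b' \<le> v" "a' \<noteq> b'"
        by (fastforce simp: double_def)
      with T 3 fD(2)[of a' b'] have "a = a' \<and> b = b' \<or> a = b' \<and> b = a'" by auto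
      with * fD(1)[of a' b'] show "T = {f a b, v + a, v + b}" by auto
    qed
  qed
qed

section \<open>A 1-factorization for every odd order\<close>

definition round_robin :: "nat \<Rightarrow> nat \<Rightarrow> nat \<Rightarrow> nat" where
  "round_robin v a b = (if b = v then a + a else if a = v then b + b else a + b) mod v"

text \<open>The circle method: the vertices are the residues modulo \<open>v\<close> and a point at
  infinity, numbered \<open>v\<close>. Edges between residues with the same sum share a factor, and
  infinity is joined to \<open>a\<close> in factor 2a, the value that the excluded diagonal leaves
  free in row \<open>a\<close>. Row \<open>v\<close> is doubling of residues, which is injective
  because \<open>v\<close> is odd.\<close>

lemma one_factorization_round_robin:
  assumes "odd v"
  shows "one_factorization v (round_robin v)"
  unfolding one_factorization_def
proof (intro conjI allI impI)
  show "round_robin v a b = round_robin v b a" for a b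
    by (simp add: round_robin_def add.commute)
  fix a assume a: "a \<le> v"
  have v: "v > 0" using assms by (auto intro: Nat.gr0I)
  have cancel: "b = b'" if "(c + b) mod v = (c + b') mod v" "b < v" "b' < v" for b b' c
    using that by (metis cong_add_lcancel_nat cong_def mod_less)
  have cancel2: "b = b'" if "(b + b) mod v = (b' + b') mod v" "b < v" "b' < v" for b b'
  proof -
    have "[2 * b = 2 * b'] (mod v)" using that by (simp add: cong_def mult_2)
    then have "[b = b'] (mod v)"
      using assms by (simp add: cong_mult_lcancel_nat)
    then show ?thesis using that by (simp add: cong_def)
  qed
  have inj: "inj_on (round_robin v a) ({..v} - {a})"
  proof (rule inj_onI)
    fix b b' assume *: "b \<in> {..v} - {a}" "b' \<in> {..v} - {a}" "round_robin v a b = round_robin v a b'"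
    show "b = b'"
    proof (cases "a = v")
      case True
      with * cancel2[of b b'] show ?thesis by (auto simp: round_robin_def)
    next
      case False
      \<comment> \<open>If one of \<open>b\<close>, \<open>b'\<close> is the vertex
        \<open>v\<close>, its entry comes from \<open>a + a\<close> and would force the other one to
        be \<open>a\<close>, which is excluded.\<close>
      with * a cancel[of a b b'] cancel[of a a b'] cancel[of a b a] show ?thesis
        by (auto simp: round_robin_def split: if_splits)
    qed
  qed
  have "round_robin v a ` ({..v} - {a}) = {..<v}"
  proof (rule card_subset_eq)
    show "round_robin v a ` ({..v} - {a}) \<subseteq> {..<v}" using v by (auto simp: round_robin_def)
    show "card (round_robin v a ` ({..v} - {a})) = card {..<v}"
      using a by (simp add: card_image[OF inj])
  qed simp
  with inj show "bij_betw (round_robin v a) ({..v} - {a}) {..<v}"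
    by (simp add: bij_betw_def)
qed

section \<open>Bicolorings of a doubled system\<close>

definition bicoloring :: "nat set set \<Rightarrow> (nat \<Rightarrow> nat) \<Rightarrow> bool" where
  "bicoloring B c \<longleftrightarrow> (\<forall>T\<in>B. card (c ` T) = 2)"

definition extend_coloring :: "nat \<Rightarrow> (nat \<Rightarrow> nat) \<Rightarrow> (nat \<Rightarrow> nat) \<Rightarrow> nat \<Rightarrow> nat" where
  "extend_coloring v c d x = (if x < v then c x else d (x - v))"

lemma extend_coloring_simps [simp]:
  "x < v \<Longrightarrow> extend_coloring v c d x = c x"
  "extend_coloring v c d (v + a) = d a"
  by (simp_all add: extend_coloring_def)

lemma range_extend_coloring:
  "extend_coloring v c d ` {..<2 * v + 1} = c ` {..<v} \<union> d ` {..v}"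
proof -
  have "{..<2 * v + 1} = {..<v} \<union> (+) v ` {..v}"
    by (auto simp: atMost_atLeast0 image_add_atLeastAtMost)
  then show ?thesis
    by (auto simp: image_Un image_image)
qed

text \<open>Old triples keep their colors, so only the new triples impose a condition. The last
  assumption is the compatibility of the 1-factorization with the colorings of the old and the new
  points.\<close>

lemma bicoloring_double:
  assumes B: "steiner_triple_system v {..<v} B" and f: "one_factorization v f"
    and c: "bicoloring B c"
    and d: "\<And>a b. a \<le> v \<Longrightarrow> b \<le> v \<Longrightarrow> a \<noteq> b \<Longrightarrow> card {c (f a b), d a, d b} = 2"
  shows "bicoloring (double v f B) (extend_coloring v c d)"
  unfolding bicoloring_def
proof
  fix T assume "T \<in> double v f B"
  then consider "T \<in> B" | a b where "T = {f a b, v + a, v + b}" "a \<le> v" "b \<le> v" "a \<noteq> b"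
    by (auto simp: double_def)
  then show "card (extend_coloring v c d ` T) = 2"
  proof cases
    case 1
    then have "extend_coloring v c d ` T = c ` T"
      using B by (intro image_cong) (fastforce simp: steiner_triple_system_def)+
    with 1 c show ?thesis by (simp add: bicoloring_def)
  next
    case 2
    then show ?thesis
      using one_factorizationD(2)[OF f, of a b] d[of a b] by simp
  qed
qed

lemma bicoloring_double_new_color:
  assumes "steiner_triple_system v {..<v} B" "one_factorization v f" "bicoloring B c"
    and k: "k \<notin> c ` {..<v}"
  shows "bicoloring (double v f B) (extend_coloring v c (\<lambda>_. k))"
proof (rule bicoloring_double[OF assms(1-3)])
  fix a b assume "a \<le> v" "b \<le> v" "a \<noteq> b"
  then have "c (f a b) \<noteq> k"
    using k one_factorizationD(2)[OF assms(2), of a b] by auto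
  then show "card {c (f a b), k, k} = 2" by simp
qed

lemma card_range_new_color:
  assumes "k \<notin> c ` {..<v}"
  shows "card (extend_coloring v c (\<lambda>_. k) ` {..<2 * v + 1}) = Suc (card (c ` {..<v}))"
  using assms unfolding range_extend_coloring by (simp add: image_constant_conv)

section \<open>Iterated doubling and the chromatic numbers\<close>

definition two_palettes :: "nat \<Rightarrow> bool" where
  "two_palettes v \<longleftrightarrow> (\<exists>B c c'. steiner_triple_system v {..<v} B \<and> bicoloring B c \<and> bicoloring B c' \<and>
     card (c ` {..<v}) \<noteq> card (c' ` {..<v}))"

text \<open>One 1-factorization serves both colorings, so they live on the same double. Each
  receives its own fresh color; both counts rise by one and stay distinct.\<close>

lemma two_palettes_double:
  assumes "two_palettes v" "odd v"
  shows "two_palettes (2 * v + 1)"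
proof -
  obtain B c c' where B: "steiner_triple_system v {..<v} B" "bicoloring B c" "bicoloring B c'"
    "card (c ` {..<v}) \<noteq> card (c' ` {..<v})"
    using assms(1) by (auto simp: two_palettes_def)
  have f: "one_factorization v (round_robin v)"
    by (rule one_factorization_round_robin[OF assms(2)])
  obtain k where k: "k \<notin> c ` {..<v}" using ex_new_if_finite[of "c ` {..<v}"] by auto
  obtain k' where k': "k' \<notin> c' ` {..<v}" using ex_new_if_finite[of "c' ` {..<v}"] by auto
  show ?thesis
    unfolding two_palettes_def
    using steiner_double[OF B(1) f] bicoloring_double_new_color[OF B(1) f B(2) k]
      bicoloring_double_new_color[OF B(1) f B(3) k'] card_range_new_color[OF k]
      card_range_new_color[OF k'] B(4)
    by (metis nat.inject)
qed

lemma two_palettes_iterate: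
  assumes "two_palettes v" "odd v"
  shows "two_palettes (2 ^ t * (v + 1) - 1)"
proof (induction t)
  case 0
  then show ?case using assms by simp
next
  case (Suc t)
  \<comment> \<open>Already for \<open>t = 0\<close> the product is even, because \<open>v\<close>
    is odd.\<close>
  have "odd (2 ^ t * (v + 1) - 1)" using assms(2) by simp
  from two_palettes_double[OF Suc.IH this]
  have "two_palettes (2 * (2 ^ t * (v + 1) - 1) + 1)" .
  \<comment> \<open>Positivity keeps the truncated subtraction exact.\<close>
  moreover have "2 * (n - 1) + 1 = 2 * n - 1" if "n > 0" for n :: nat
    using that by simp
  ultimately show ?case by (simp add: mult.assoc)
qed

text \<open>Every attained number of colors lies between the minimum and the maximum, so two
  different ones keep these apart.\<close>

lemma two_palettes_imp_distinct_chromatic_numbers: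
  assumes "two_palettes w"
  shows "\<exists>(V :: nat set) B. steiner_triple_system w V B \<and> bicolorable V B \<and>
           lower_chromatic_number V B \<noteq> upper_chromatic_number V B"
proof -
  obtain B c c' where B: "steiner_triple_system w {..<w} B" and c: "bicoloring B c" "bicoloring B c'"
    and ne: "card (c ` {..<w}) \<noteq> card (c' ` {..<w})"
    using assms by (auto simp: two_palettes_def)
  let ?P = "\<lambda>k. has_strict_bicoloring k {..<w} B"
  have P: "?P (card (c ` {..<w}))" "?P (card (c' ` {..<w}))"
    using c by (auto simp: has_strict_bicoloring_def strict_bicoloring_def bicoloring_def)
  \<comment> \<open>\<open>GREATEST\<close> is meaningful only for a bounded set of attained
    numbers.\<close>
  have bound: "k \<le> w" if "?P k" for k
    using that card_image_le[of "{..<w}"]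
    by (auto simp: has_strict_bicoloring_def strict_bicoloring_def)
  have "lower_chromatic_number {..<w} B \<le> k \<and> k \<le> upper_chromatic_number {..<w} B" if "?P k" for k
    unfolding lower_chromatic_number_def upper_chromatic_number_def
    using Least_le[of ?P k, OF that] Greatest_le_nat[of ?P k w, OF that] bound by simp
  from this[OF P(1)] this[OF P(2)] ne
  have "lower_chromatic_number {..<w} B \<noteq> upper_chromatic_number {..<w} B" by linarith
  with B P(1) show ?thesis by (auto simp: bicolorable_def)
qed


section \<open>Table checks\<close>

text \<open>A symmetric matrix is stored as its upper triangle, so that row \<open>i\<close> of the table starts at the
  diagonal. Carrying the transposed upper part in the first argument completes the rows without
  random access, which keeps symbolic evaluation cheap.\<close>

fun sym_rows :: "'a list list \<Rightarrow> 'a list list \<Rightarrow> 'a list list" where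
  "sym_rows (p # ps) (u # us) = (p @ u) # sym_rows (map2 (\<lambda>q x. q @ [x]) ps (tl u)) us"
| "sym_rows _ _ = []"

definition symmetric_table :: "'a list list \<Rightarrow> 'a list list" where
  "symmetric_table us = sym_rows (replicate (length us) []) us"

definition triangular :: "'a list list \<Rightarrow> bool" where
  "triangular us \<longleftrightarrow> map length us = rev [1..<Suc (length us)]"

text \<open>Points are numbered such that color classes are intervals; the list holds the class sizes.\<close>

fun class_of :: "nat list \<Rightarrow> nat \<Rightarrow> nat" where
  "class_of [] x = 0"
| "class_of (s # ss) x = (if x < s then 0 else Suc (class_of ss (x - s)))"

text \<open>Equality tests are easier to evaluate than the cardinality of an image;
  \<open>two_colored_iff\<close> connects the two.\<close>

definition two_colored :: "nat \<Rightarrow> nat \<Rightarrow> nat \<Rightarrow> bool" where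
  "two_colored a b c \<longleftrightarrow> (if a = b then b \<noteq> c else a = c \<or> b = c)"

text \<open>The table of a Steiner triple system is its Steiner quasigroup: \<open>x \<cdot> x = x\<close>, and \<open>x \<cdot> y\<close> is the third
  point of the triple on \<open>x \<noteq> y\<close>. An idempotent symmetric table is of this kind iff each
  row is an involution.\<close>

definition steiner_row :: "(nat \<Rightarrow> nat) \<Rightarrow> nat \<Rightarrow> nat \<Rightarrow> nat list \<Rightarrow> bool" where
  "steiner_row c v x r \<longleftrightarrow>
     r ! x = x \<and> list_all (\<lambda>z. z < v) r \<and> map ((!) r) r = [0..<v] \<and>
     list_all (\<lambda>(y, z). z = x \<or> two_colored (c x) (c y) (c z)) (zip [0..<v] r)"

text \<open>In a table of a 1-factorization, the entry at \<open>a, b\<close> is the factor containing the edge \<open>ab\<close>.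
  The dummy value \<open>v\<close> on the diagonal turns every row into a permutation.\<close>

definition factor_row :: "(nat \<Rightarrow> nat) \<Rightarrow> (nat \<Rightarrow> nat) \<Rightarrow> nat \<Rightarrow> nat \<Rightarrow> nat list \<Rightarrow> bool" where
  "factor_row c d v a r \<longleftrightarrow>
     r ! a = v \<and> list_all (\<lambda>x. x \<le> v) r \<and> distinct r \<and>
     list_all (\<lambda>(b, x). x = v \<or> two_colored (d a) (d b) (c x)) (zip [0..<Suc v] r)"

definition steiner_table :: "nat list \<Rightarrow> nat \<Rightarrow> nat list list \<Rightarrow> bool" where
  "steiner_table n v us \<longleftrightarrow> triangular us \<and> length us = v \<and>
     list_all (\<lambda>(x, r). steiner_row (class_of n) v x r) (zip [0..<v] (symmetric_table us))"

definition factor_table :: "nat list \<Rightarrow> nat list \<Rightarrow> nat \<Rightarrow> nat list list \<Rightarrow> bool" where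
  "factor_table n m v us \<longleftrightarrow> triangular us \<and> length us = Suc v \<and>
     list_all (\<lambda>(a, r). factor_row (class_of n) (class_of m) v a r) (zip [0..<Suc v] (symmetric_table us))"

text \<open>Ensures that the new points bring in no further color, so that the double has as many
  colors as the old system. Dropping duplicates makes each membership test run over a short
  list.\<close>

definition colors_within :: "nat list \<Rightarrow> nat list \<Rightarrow> nat \<Rightarrow> bool" where
  "colors_within n m v \<longleftrightarrow> (let cs = remdups (map (class_of n) [0..<v]) in
     list_all (\<lambda>a. class_of m a \<in> set cs) [0..<Suc v])"

section \<open>Soundness of the table checks\<close>

lemma two_colored_iff: "two_colored a b c \<longleftrightarrow> card {a, b, c} = 2"
  by (auto simp: two_colored_def card_insert_if)

lemma triangular_Cons [simp]:
  "triangular (u # us) \<longleftrightarrow> length u = Suc (length us) \<and> triangular us"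
  by (auto simp: triangular_def)

text \<open>The prefixes \<open>ps\<close> are arbitrary because the recursion lengthens them. The
  induction borders a symmetric function for the smaller triangle with \<open>u\<close>, which
  becomes both its first row and its first column.\<close>

lemma sym_rows_eq:
  assumes "triangular us" "length ps = length us"
  shows "\<exists>s. (\<forall>i j. s i j = s j i) \<and> length (sym_rows ps us) = length us \<and>
    (\<forall>i<length us. sym_rows ps us ! i = ps ! i @ map (s i) [0..<length us])"
  using assms
proof (induction us arbitrary: ps)
  case Nil
  then show ?case by auto
next
  case (Cons u us)
  then obtain p ps' where ps: "ps = p # ps'" "length ps' = length us"
    by (metis length_Suc_conv)
  let ?qs = "map2 (\<lambda>q x. q @ [x]) ps' (tl u)"
  have u: "length u = Suc (length us)" "triangular us" "length ?qs = length us"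
    using Cons.prems ps by auto
  obtain s where s: "\<And>i j. s i j = s j i" "length (sym_rows ?qs us) = length us"
    "\<And>i. i < length us \<Longrightarrow> sym_rows ?qs us ! i = ?qs ! i @ map (s i) [0..<length us]"
    using Cons.IH[OF u(2,3)] by blast
  define s' where "s' = (\<lambda>i j. case i of 0 \<Rightarrow> u ! j |
    Suc i' \<Rightarrow> (case j of 0 \<Rightarrow> u ! i | Suc j' \<Rightarrow> s i' j'))"
  have sym: "s' i j = s' j i" for i j
    using s(1) by (auto simp: s'_def split: nat.splits)
  have upt: "[0..<Suc (length us)] = 0 # map Suc [0..<length us]"
    by (simp add: map_Suc_upt upt_conv_Cons del: upt_Suc)
  have "map (s' 0) [0..<Suc (length us)] = u"
    using map_nth[of u] u(1) by (simp add: s'_def del: upt_Suc)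
  \<comment> \<open>The entry \<open>tl u ! i\<close> is the one that the recursion appends to the
    prefix of this row; here it reappears as column 0.\<close>
  moreover have "map (s' (Suc i)) [0..<Suc (length us)] = tl u ! i # map (s i) [0..<length us]"
    if "i < length us" for i
    using that u(1) by (auto simp: s'_def upt nth_tl simp del: upt_Suc)
  ultimately have "sym_rows ps (u # us) ! i = ps ! i @ map (s' i) [0..<length (u # us)]"
    if "i < length (u # us)" for i
    using that ps s(3) u by (cases i) (auto simp del: upt_Suc)
  moreover have "length (sym_rows ps (u # us)) = length (u # us)"
    using ps s(2) by simp
  ultimately show ?case using sym by blast
qed

text \<open>Symmetry comes with the storage format, so only the shape of the triangle has to be
  tested.\<close>

lemma symmetric_table_eq:
  assumes "triangular us"
  obtains s where "\<And>i j. s i j = s j i"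
    "symmetric_table us = map (\<lambda>i. map (s i) [0..<length us]) [0..<length us]"
proof -
  obtain s where s: "\<And>i j. s i j = s j i" "length (symmetric_table us) = length us"
    "\<And>i. i < length us \<Longrightarrow> symmetric_table us ! i = map (s i) [0..<length us]"
    using sym_rows_eq[OF assms, of "replicate (length us) []"]
    by (auto simp: symmetric_table_def)
  then have "symmetric_table us = map (\<lambda>i. map (s i) [0..<length us]) [0..<length us]"
    by (auto intro: nth_equalityI)
  with s(1) that show thesis by blast
qed

lemma list_all_zip_upt:
  "length xs = n \<Longrightarrow> list_all P (zip [0..<n] xs) \<longleftrightarrow> (\<forall>i<n. P (i, xs ! i))"
  by (auto simp: list_all_length)

text \<open>Commutativity and x \<cdot> (x \<cdot> y) = y make each point of {x, y, x \<cdot> y} the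
  product of the other two, so any two points of a triple determine it.\<close>

lemma steiner_of_quasigroup:
  assumes sym: "\<And>x y. q x y = q y x"
    and lt: "\<And>x y. x < v \<Longrightarrow> y < v \<Longrightarrow> q x y < v"
    and idem: "\<And>x. x < v \<Longrightarrow> q x x = x"
    and inv: "\<And>x y. x < v \<Longrightarrow> y < v \<Longrightarrow> q x (q x y) = y"
  shows "steiner_triple_system v {..<v} {{x, y, q x y} |x y. x < v \<and> y < v \<and> x \<noteq> y}"
    (is "steiner_triple_system v _ ?B")
  unfolding steiner_triple_system_iff
proof (intro conjI ballI impI)
  \<comment> \<open>If x \<cdot> y = x, then y = x \<cdot> (x \<cdot> y) = x \<cdot> x = x; the
    other case is symmetric.\<close>
  have ne: "q x y \<noteq> x" "q x y \<noteq> y" if "x < v" "y < v" "x \<noteq> y" for x y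
    using inv[of x y] inv[of y x] idem that sym by metis+
  show "T \<subseteq> {..<v}" "card T = 3" if T: "T \<in> ?B" for T
  proof -
    from T obtain x y where xy: "T = {x, y, q x y}" "x < v" "y < v" "x \<noteq> y" by auto
    show "T \<subseteq> {..<v}" "card T = 3"
      using xy lt[of x y] ne[of x y] by auto
  qed
  fix x y assume xy: "x \<in> {..<v}" "y \<in> {..<v}" "x < y"
  show "\<exists>!T. T \<in> ?B \<and> x \<in> T \<and> y \<in> T"
  proof (rule ex1I)
    show "{x, y, q x y} \<in> ?B \<and> x \<in> {x, y, q x y} \<and> y \<in> {x, y, q x y}"
      using xy by blast
    fix T assume T: "T \<in> ?B \<and> x \<in> T \<and> y \<in> T"
    then obtain a b where ab: "T = {a, b, q a b}" "a < v" "b < v" by auto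
    \<comment> \<open>Whichever two points of \<open>T\<close> are \<open>x\<close> and
      \<open>y\<close>, these products show that the third one is \<open>q x y\<close>.\<close>
    have "q b (q a b) = a" "q a (q a b) = b"
      using ab inv sym by metis+
    with T ab(1) xy(3) show "T = {x, y, q x y}"
      using sym by auto
  qed
qed simp_all

lemma steiner_tableE:
  assumes "steiner_table n v us"
  obtains B where "steiner_triple_system v {..<v} B" "bicoloring B (class_of n)"
proof -
  have tri: "triangular us" "length us = v" using assms by (auto simp: steiner_table_def)
  obtain q where q: "\<And>x y. q x y = q y x"
    "symmetric_table us = map (\<lambda>x. map (q x) [0..<v]) [0..<v]"
    using symmetric_table_eq[OF tri(1)] tri(2) by metis
  have row: "steiner_row (class_of n) v x (map (q x) [0..<v])" if "x < v" for x
    using assms that by (simp add: steiner_table_def q(2) list_all_zip_upt)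
  have idem: "q x x = x" and lt: "y < v \<Longrightarrow> q x y < v" if "x < v" for x y
    using row[OF that] that by (auto simp: steiner_row_def list_all_iff)
  have inv: "q x (q x y) = y" if "x < v" "y < v" for x y
  proof -
    \<comment> \<open>Reading the row through itself composes the map \<open>q x\<close> with
      itself.\<close>
    have "map ((!) (map (q x) [0..<v])) (map (q x) [0..<v]) ! y = [0..<v] ! y"
      using row[OF that(1)] by (simp only: steiner_row_def)
    then show ?thesis using that lt[OF that] by simp
  qed
  have color: "card {class_of n x, class_of n y, class_of n (q x y)} = 2"
    if "x < v" "y < v" "x \<noteq> y" for x y
  proof -
    \<comment> \<open>The color check in \<open>steiner_row\<close> exempts entries equal to
      \<open>x\<close>; by the involution property these occur only on the diagonal.\<close>
    have "q x y \<noteq> x" using inv[of x y] idem that by metis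
    with row[OF that(1)] that show ?thesis
      by (auto simp: steiner_row_def list_all_zip_upt two_colored_iff)
  qed
  show thesis
  proof (rule that)
    show "steiner_triple_system v {..<v} {{x, y, q x y} |x y. x < v \<and> y < v \<and> x \<noteq> y}"
      using q(1) lt idem inv by (rule steiner_of_quasigroup)
    show "bicoloring {{x, y, q x y} |x y. x < v \<and> y < v \<and> x \<noteq> y} (class_of n)"
      using color by (auto simp: bicoloring_def)
  qed
qed

lemma factor_tableE:
  assumes "factor_table n m v us"
  obtains f where "one_factorization v f"
    "\<And>a b. a \<le> v \<Longrightarrow> b \<le> v \<Longrightarrow> a \<noteq> b \<Longrightarrow> card {class_of n (f a b), class_of m a, class_of m b} = 2"
proof -
  have tri: "triangular us" "length us = Suc v" using assms by (auto simp: factor_table_def)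
  obtain f where f: "\<And>a b. f a b = f b a"
    "symmetric_table us = map (\<lambda>a. map (f a) [0..<Suc v]) [0..<Suc v]"
    using symmetric_table_eq[OF tri(1)] tri(2) by metis
  have row: "factor_row (class_of n) (class_of m) v a (map (f a) [0..<Suc v])" if "a \<le> v" for a
    using assms that by (simp add: factor_table_def f(2) list_all_zip_upt less_Suc_eq_le del: upt_Suc)
  have diag: "f a a = v" and le: "b \<le> v \<Longrightarrow> f a b \<le> v" if "a \<le> v" for a b
    using row[OF that] that
    by (auto simp: factor_row_def list_all_iff less_Suc_eq_le simp del: upt_Suc)
  have inj: "inj_on (f a) {..v}" if "a \<le> v" for a
    using row[OF that] by (simp add: factor_row_def distinct_map lessThan_Suc_atMost
      atLeast0LessThan del: upt_Suc)
  \<comment> \<open>The diagonal already takes the value \<open>v\<close>, and rows are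
    injective.\<close>
  have ne: "f a b \<noteq> v" if "a \<le> v" "b \<le> v" "a \<noteq> b" for a b
    using inj_onD[OF inj[OF that(1)], of a b] diag that by auto
  have "bij_betw (f a) ({..v} - {a}) {..<v}" if a: "a \<le> v" for a
    unfolding bij_betw_def
  proof
    show i: "inj_on (f a) ({..v} - {a})" using inj[OF a] by (rule inj_on_subset) auto
    show "f a ` ({..v} - {a}) = {..<v}"
    proof (rule card_subset_eq)
      show "f a ` ({..v} - {a}) \<subseteq> {..<v}"
        using le[OF a] ne[OF a] by (auto intro!: le_neq_implies_less)
      show "card (f a ` ({..v} - {a})) = card {..<v}" using a by (simp add: card_image[OF i])
    qed simp
  qed
  then have "one_factorization v f" using f(1) by (simp add: one_factorization_def)
  moreover have "card {class_of n (f a b), class_of m a, class_of m b} = 2"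
    if "a \<le> v" "b \<le> v" "a \<noteq> b" for a b
  proof -
    have "two_colored (class_of m a) (class_of m b) (class_of n (f a b))"
      using row[OF that(1)] ne[OF that] that
      by (auto simp: factor_row_def list_all_zip_upt less_Suc_eq_le simp del: upt_Suc)
    then show ?thesis by (simp add: two_colored_iff insert_commute)
  qed
  ultimately show thesis using that by blast
qed

text \<open>The sizes \<open>m\<close> color the new points with old colors and keep the number k of
  colors. The same double also has the fresh coloring with k + 1 colors, so one pair of tables
  suffices.\<close>

lemma two_palettes_of_tables:
  assumes "steiner_table n v us" "factor_table n m v ws" "colors_within n m v"
  shows "two_palettes (2 * v + 1)"
proof -
  obtain B where B: "steiner_triple_system v {..<v} B" "bicoloring B (class_of n)"
    using assms(1) by (rule steiner_tableE)
  obtain f where f: "one_factorization v f"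
    "\<And>a b. a \<le> v \<Longrightarrow> b \<le> v \<Longrightarrow> a \<noteq> b \<Longrightarrow> card {class_of n (f a b), class_of m a, class_of m b} = 2"
    using assms(2) by (rule factor_tableE) blast
  obtain k where k: "k \<notin> class_of n ` {..<v}"
    using ex_new_if_finite[of "class_of n ` {..<v}"] by auto
  \<comment> \<open>Inclusion is enough: the old points already show every color, so a class of new
    points may be empty.\<close>
  have "class_of m ` {..v} \<subseteq> class_of n ` {..<v}"
    using assms(3) by (auto simp: colors_within_def list_all_iff atLeast0LessThan less_Suc_eq_le
        simp del: upt_Suc)
  then have "extend_coloring v (class_of n) (class_of m) ` {..<2 * v + 1} = class_of n ` {..<v}"
    unfolding range_extend_coloring by blast
  then show ?thesis
    unfolding two_palettes_def
    using steiner_double[OF B(1) f(1)] bicoloring_double[OF B(1) f(1) B(2) f(2)]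
      bicoloring_double_new_color[OF B(1) f(1) B(2) k] card_range_new_color[OF k]
    by (metis n_not_Suc_n)
qed

section \<open>Tabulated systems\<close>

definition steiner_13 :: "nat list list" where
  "steiner_13 =
    [[0, 8, 9, 12, 10, 11, 7, 6, 1, 2, 4, 5, 3], [1, 6, 10, 11, 12, 2, 9, 0, 7, 3, 4, 5], [2, 11,
    12, 7, 1, 5, 10, 0, 8, 3, 4], [3, 7, 6, 5, 4, 9, 8, 1, 2, 0], [4, 8, 9, 3, 5, 6, 0, 1, 2], [5,
    3, 2, 4, 10, 9, 0, 1], [6, 0, 11, 4, 12, 8, 10], [7, 12, 1, 11, 10, 8], [8, 3, 2, 6, 7], [9, 5,
    12, 11], [10, 7, 6], [11, 9], [12]]"

definition factors_13 :: "nat list list" where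
  "factors_13 =
    [[13, 11, 8, 12, 9, 7, 10, 6, 3, 2, 4, 5, 1, 0], [13, 7, 8, 12, 9, 6, 3, 2, 10, 1, 0, 5, 4],
    [13, 6, 11, 12, 5, 10, 9, 4, 0, 1, 2, 3], [13, 10, 11, 7, 4, 5, 9, 3, 2, 0, 1], [13, 6, 1, 7, 8,
    0, 2, 4, 3, 5], [13, 0, 1, 10, 8, 5, 3, 4, 2], [13, 2, 4, 3, 11, 12, 8, 9], [13, 0, 5, 9, 11,
    12, 8], [13, 1, 7, 6, 11, 12], [13, 12, 7, 6, 11], [13, 8, 10, 6], [13, 9, 10], [13, 7], [13]]"

text \<open>A constraint on the class sizes: a bicolored triple contains exactly one pair of equal
  color, so the pairs of equal color are as many as the triples. Here 15 + 10 + 1 = 26 = 13 * 12 /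
  6; the sizes for the larger orders solve the same equation.\<close>

lemma steiner_table_13: "steiner_table [6, 5, 2] 13 steiner_13"
  by code_simp

text \<open>A constraint on the new sizes 6, 4, 4: a factor of color i has one mixed edge at each
  new point of color i and no other mixed edges. Counting all mixed edges in two ways gives 6 * 6 +
  5 * 4 + 2 * 4 = 64 = 6 * 4 + 6 * 4 + 4 * 4. The larger orders obey the same identity.\<close>

lemma factor_table_13: "factor_table [6, 5, 2] [6, 4, 4] 13 factors_13"
  by code_simp

lemma colors_within_13: "colors_within [6, 5, 2] [6, 4, 4] 13"
  by code_simp

definition steiner_19 :: "nat list list" where
  "steiner_19 =
    [[0, 12, 18, 10, 11, 14, 16, 15, 17, 13, 3, 4, 1, 9, 5, 7, 6, 8, 2], [1, 9, 16, 10, 17, 15, 18,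
    13, 2, 4, 14, 0, 8, 11, 6, 3, 5, 7], [2, 11, 12, 13, 17, 14, 10, 1, 8, 3, 4, 5, 7, 16, 15, 6,
    0], [3, 13, 15, 12, 9, 14, 7, 0, 2, 6, 4, 8, 5, 1, 18, 17], [4, 16, 18, 17, 15, 14, 1, 0, 2, 3,
    9, 8, 5, 7, 6], [5, 11, 12, 18, 10, 9, 6, 7, 2, 0, 3, 4, 1, 8], [6, 10, 9, 8, 7, 5, 3, 14, 13,
    1, 0, 2, 4], [7, 16, 3, 6, 13, 5, 11, 2, 0, 8, 4, 1], [8, 6, 2, 12, 11, 1, 3, 4, 7, 0, 5], [9,
    5, 18, 15, 0, 4, 12, 17, 16, 11], [10, 16, 18, 15, 17, 13, 11, 14, 12], [11, 8, 7, 1, 17, 10,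
    15, 9], [12, 17, 16, 9, 14, 13, 10], [13, 6, 10, 18, 12, 16], [14, 18, 12, 10, 15], [15, 2, 11,
    14], [16, 9, 13], [17, 3], [18]]"

definition factors_19 :: "nat list list" where
  "factors_19 =
    [[19, 16, 12, 11, 18, 15, 13, 17, 10, 9, 4, 14, 3, 5, 8, 6, 0, 7, 2, 1], [19, 11, 12, 17, 18,
    15, 13, 9, 5, 10, 4, 14, 3, 2, 1, 6, 0, 8, 7], [19, 17, 10, 16, 18, 15, 6, 7, 14, 9, 13, 8, 1,
    0, 5, 2, 3, 4], [19, 15, 10, 16, 18, 8, 6, 9, 13, 7, 14, 5, 3, 1, 4, 0, 2], [19, 9, 14, 16, 7,
    12, 13, 8, 6, 11, 4, 5, 2, 3, 1, 0], [19, 17, 14, 12, 11, 7, 6, 8, 13, 0, 2, 3, 1, 4, 5], [19,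
    9, 2, 1, 0, 10, 11, 12, 3, 4, 7, 6, 5, 8], [19, 11, 10, 2, 0, 12, 1, 6, 8, 4, 5, 7, 3], [19, 0,
    3, 1, 5, 4, 17, 18, 14, 13, 16, 15], [19, 8, 3, 4, 2, 16, 17, 18, 15, 14, 13], [19, 5, 1, 6, 15,
    11, 17, 18, 12, 16], [19, 2, 7, 12, 15, 11, 16, 18, 17], [19, 0, 10, 9, 16, 17, 15, 18], [19,
    18, 16, 15, 9, 17, 10], [19, 7, 13, 14, 11, 9], [19, 10, 12, 13, 14], [19, 8, 9, 12], [19, 10,
    11], [19, 6], [19]]"

lemma steiner_table_19: "steiner_table [9, 6, 4] 19 steiner_19"
  by code_simp

lemma factor_table_19: "factor_table [9, 6, 4] [8, 6, 6] 19 factors_19"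
  by code_simp

lemma colors_within_19: "colors_within [9, 6, 4] [8, 6, 6] 19"
  by code_simp

definition steiner_21 :: "nat list list" where
  "steiner_21 =
    [[0, 18, 9, 19, 11, 15, 13, 20, 17, 2, 14, 4, 16, 6, 10, 5, 12, 8, 1, 3, 7], [1, 14, 20, 17, 19,
    12, 11, 15, 10, 9, 7, 6, 16, 2, 8, 13, 4, 0, 5, 3], [2, 17, 19, 16, 15, 13, 10, 0, 8, 12, 11, 7,
    1, 6, 5, 3, 20, 4, 18], [3, 12, 13, 11, 14, 18, 16, 15, 6, 4, 5, 7, 10, 9, 2, 8, 0, 1], [4, 20,
    9, 18, 16, 6, 13, 0, 3, 10, 15, 14, 8, 1, 7, 2, 5], [5, 14, 10, 12, 11, 7, 9, 8, 3, 6, 0, 2, 18,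
    17, 1, 4], [6, 17, 20, 4, 16, 3, 1, 0, 5, 2, 10, 7, 19, 18, 8], [7, 19, 12, 5, 1, 9, 2, 3, 16,
    15, 6, 4, 8, 0], [8, 13, 2, 14, 5, 9, 11, 1, 4, 0, 3, 7, 6], [9, 1, 5, 7, 8, 20, 18, 3, 19, 15,
    17, 14], [10, 17, 18, 4, 0, 3, 6, 11, 12, 20, 19], [11, 2, 18, 8, 20, 19, 10, 13, 16, 15], [12,
    20, 17, 19, 0, 14, 10, 15, 13], [13, 19, 17, 1, 15, 11, 14, 12], [14, 4, 18, 12, 16, 13, 9],
    [15, 7, 13, 9, 12, 11], [16, 20, 14, 11, 17], [17, 5, 9, 16], [18, 6, 2], [19, 10], [20]]"

definition factors_21 :: "nat list list" where
  "factors_21 =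
    [[21, 19, 14, 13, 20, 15, 17, 18, 9, 16, 10, 6, 11, 5, 7, 12, 8, 2, 0, 4, 3, 1], [21, 18, 12,
    17, 20, 11, 10, 15, 9, 6, 7, 16, 13, 14, 5, 2, 0, 1, 3, 8, 4], [21, 19, 12, 11, 20, 17, 16, 15,
    13, 9, 10, 6, 8, 7, 4, 3, 2, 1, 0, 5], [21, 18, 17, 10, 20, 8, 7, 9, 14, 6, 15, 11, 16, 5, 4, 3,
    0, 1, 2], [21, 9, 19, 16, 4, 10, 15, 8, 3, 11, 13, 14, 1, 6, 7, 5, 2, 0], [21, 18, 19, 3, 4, 8,
    10, 12, 14, 16, 13, 0, 1, 6, 2, 5, 7], [21, 9, 2, 0, 1, 13, 14, 16, 12, 15, 3, 5, 4, 6, 7, 8],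
    [21, 0, 11, 14, 15, 13, 12, 1, 2, 6, 8, 5, 7, 4, 3], [21, 17, 18, 19, 7, 1, 5, 6, 20, 12, 14,
    11, 13, 10], [21, 2, 5, 1, 3, 6, 8, 13, 20, 12, 19, 14, 18], [21, 0, 5, 7, 4, 3, 16, 19, 20, 12,
    17, 11], [21, 2, 4, 3, 1, 11, 17, 18, 20, 12, 16], [21, 8, 0, 4, 19, 15, 9, 18, 20, 17], [21, 2,
    0, 17, 18, 19, 9, 10, 20], [21, 20, 15, 9, 17, 10, 18, 19], [21, 18, 10, 11, 17, 19, 9], [21, 7,
    10, 14, 9, 12], [21, 13, 16, 11, 14], [21, 8, 16, 15], [21, 15, 13], [21, 6], [21]]"

lemma steiner_table_21: "steiner_table [9, 8, 4] 21 steiner_21"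
  by code_simp

lemma factor_table_21: "factor_table [9, 8, 4] [8, 8, 6] 21 factors_21"
  by code_simp

lemma colors_within_21: "colors_within [9, 8, 4] [8, 8, 6] 21"
  by code_simp

definition steiner_25 :: "nat list list" where
  "steiner_25 =
    [[0, 20, 17, 24, 13, 16, 14, 15, 22, 18, 23, 21, 19, 4, 6, 7, 5, 2, 9, 12, 1, 11, 8, 10, 3], [1,
    13, 14, 24, 21, 18, 19, 12, 22, 15, 23, 8, 2, 3, 10, 17, 16, 6, 7, 0, 5, 9, 11, 4], [2, 15, 22,
    12, 16, 20, 19, 14, 18, 24, 5, 1, 9, 3, 6, 0, 10, 8, 7, 23, 4, 21, 11], [3, 17, 19, 20, 16, 23,
    21, 22, 12, 11, 18, 1, 2, 7, 4, 13, 5, 6, 9, 10, 8, 0], [4, 23, 15, 12, 21, 19, 16, 20, 7, 0,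
    18, 6, 10, 3, 14, 9, 11, 8, 2, 5, 1], [5, 24, 17, 18, 15, 13, 14, 2, 10, 11, 9, 0, 7, 8, 3, 22,
    1, 20, 4, 6], [6, 23, 17, 12, 21, 22, 9, 19, 0, 4, 2, 8, 1, 13, 3, 10, 11, 7, 5], [7, 24, 13,
    14, 18, 4, 9, 10, 0, 3, 5, 11, 1, 2, 22, 21, 6, 8], [8, 16, 20, 13, 1, 11, 15, 14, 9, 6, 5, 2,
    10, 4, 0, 3, 7], [9, 24, 17, 6, 7, 2, 5, 8, 11, 0, 4, 23, 3, 1, 20, 10], [10, 19, 17, 5, 7, 1,
    4, 12, 2, 11, 8, 6, 3, 0, 9], [11, 3, 8, 5, 16, 15, 9, 7, 10, 4, 0, 6, 1, 2], [12, 22, 24, 20,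
    23, 10, 21, 0, 15, 18, 13, 16, 14], [13, 20, 23, 21, 24, 3, 6, 14, 16, 12, 15, 17], [14, 8, 22,
    23, 4, 21, 13, 19, 16, 17, 12], [15, 11, 21, 24, 22, 12, 17, 19, 13, 18], [16, 1, 20, 24, 18,
    13, 14, 12, 19], [17, 22, 20, 19, 15, 18, 14, 13], [18, 23, 16, 12, 17, 19, 15], [19, 17, 14,
    15, 18, 16], [20, 24, 5, 9, 21], [21, 7, 2, 20], [22, 24, 23], [23, 22], [24]]"

definition factors_25 :: "nat list list" where
  "factors_25 =
    [[25, 21, 23, 17, 24, 20, 18, 22, 13, 19, 11, 14, 12, 6, 9, 8, 7, 16, 10, 15, 2, 1, 0, 4, 3, 5],
    [25, 22, 23, 15, 24, 20, 16, 12, 18, 13, 19, 7, 17, 8, 6, 14, 9, 11, 10, 1, 0, 2, 3, 5, 4], [25,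
    13, 14, 21, 24, 20, 19, 11, 18, 12, 10, 9, 15, 17, 8, 6, 16, 7, 5, 4, 1, 2, 0, 3], [25, 20, 22,
    21, 24, 18, 12, 19, 10, 6, 8, 16, 11, 15, 14, 7, 9, 0, 3, 4, 5, 2, 1], [25, 23, 22, 21, 1, 0, 5,
    2, 13, 12, 3, 4, 16, 17, 18, 19, 8, 10, 9, 6, 11, 7], [25, 12, 19, 5, 2, 0, 18, 4, 13, 1, 14,
    17, 3, 15, 16, 7, 6, 11, 9, 10, 8], [25, 23, 0, 5, 2, 1, 19, 4, 13, 16, 3, 15, 14, 17, 6, 8, 10,
    7, 9, 11], [25, 2, 13, 12, 0, 18, 14, 17, 15, 1, 5, 3, 4, 11, 7, 6, 10, 8, 9], [25, 21, 10, 11,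
    3, 22, 24, 7, 4, 8, 9, 6, 23, 17, 14, 16, 15, 20], [25, 1, 22, 9, 10, 4, 24, 6, 7, 8, 3, 16, 23,
    17, 20, 14, 15], [25, 21, 22, 3, 7, 9, 24, 4, 6, 8, 15, 20, 23, 17, 16, 14], [25, 8, 7, 6, 3, 9,
    24, 4, 5, 13, 15, 20, 23, 17, 16], [25, 0, 2, 5, 20, 11, 24, 1, 21, 14, 16, 15, 23, 17], [25,
    21, 2, 11, 1, 5, 24, 20, 16, 15, 18, 19, 23], [25, 0, 5, 10, 23, 11, 22, 19, 18, 14, 20, 12],
    [25, 10, 23, 1, 20, 12, 22, 19, 21, 18, 13], [25, 0, 2, 23, 19, 21, 22, 13, 12, 18], [25, 20, 2,
    18, 13, 12, 22, 21, 19], [25, 0, 17, 12, 13, 19, 22, 21], [25, 14, 18, 21, 12, 13, 22], [25, 9,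
    3, 24, 4, 10], [25, 5, 11, 24, 2], [25, 8, 7, 24], [25, 1, 0], [25, 6], [25]]"

lemma steiner_table_25: "steiner_table [12, 8, 4, 1] 25 steiner_25"
  by code_simp

text \<open>The fourth color belongs to a single old point and to no new point. In the factor of
  that old point every edge stays inside a class, which requires 8, 12 and 6 to be even.\<close>

lemma factor_table_25: "factor_table [12, 8, 4, 1] [8, 12, 6, 0] 25 factors_25"
  by code_simp

lemma colors_within_25: "colors_within [12, 8, 4, 1] [8, 12, 6, 0] 25"
  by code_simp

definition steiner_31 :: "nat list list" where
  "steiner_31 =
    [[0, 21, 27, 17, 25, 24, 28, 14, 16, 19, 30, 29, 15, 18, 7, 12, 8, 3, 13, 9, 22, 1, 20, 26, 5,
    4, 23, 2, 6, 11, 10], [1, 24, 23, 27, 26, 18, 22, 29, 15, 14, 28, 16, 20, 10, 9, 12, 19, 6, 17,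
    13, 0, 7, 3, 2, 30, 5, 4, 11, 8, 25], [2, 30, 19, 17, 20, 25, 23, 16, 18, 15, 26, 21, 22, 11, 9,
    5, 10, 4, 6, 13, 14, 8, 1, 7, 12, 0, 29, 28, 3], [3, 14, 22, 21, 20, 25, 18, 29, 16, 19, 15, 4,
    13, 11, 0, 9, 12, 7, 6, 5, 1, 27, 8, 28, 24, 26, 10, 2], [4, 15, 30, 24, 26, 20, 28, 22, 21, 17,
    3, 5, 18, 13, 16, 2, 9, 12, 11, 29, 7, 0, 8, 1, 10, 23, 6], [5, 27, 28, 30, 29, 25, 14, 20, 23,
    11, 4, 21, 2, 19, 18, 12, 16, 3, 13, 0, 10, 1, 6, 7, 9, 8], [6, 23, 17, 26, 19, 24, 22, 16, 15,
    14, 13, 8, 1, 10, 2, 3, 12, 7, 11, 29, 9, 5, 0, 25, 4], [7, 21, 30, 26, 27, 29, 19, 0, 16, 15,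
    18, 17, 13, 3, 8, 1, 6, 4, 2, 10, 11, 5, 12, 9], [8, 28, 27, 19, 24, 22, 20, 18, 0, 6, 15, 11,
    14, 7, 13, 2, 12, 3, 4, 10, 9, 1, 5], [9, 22, 21, 27, 25, 17, 1, 2, 14, 3, 0, 4, 11, 10, 24, 23,
    13, 6, 12, 8, 5, 7], [10, 23, 17, 24, 1, 21, 20, 12, 2, 6, 16, 15, 9, 11, 13, 5, 7, 8, 4, 3, 0],
    [11, 18, 30, 5, 2, 3, 20, 12, 8, 17, 9, 4, 10, 6, 26, 25, 7, 1, 0, 13], [12, 14, 13, 0, 1, 10,
    11, 3, 5, 4, 6, 25, 8, 23, 2, 9, 30, 7, 28], [13, 12, 3, 6, 4, 0, 7, 1, 2, 8, 5, 10, 9, 29, 28,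
    27, 26, 11], [14, 6, 23, 9, 27, 28, 8, 26, 2, 16, 25, 24, 21, 18, 19, 30, 29], [15, 7, 26, 8,
    25, 23, 10, 29, 20, 28, 19, 17, 30, 24, 22, 27], [16, 28, 4, 29, 10, 5, 25, 14, 30, 22, 27, 26,
    17, 19, 24], [17, 7, 1, 11, 25, 24, 30, 22, 21, 15, 29, 16, 27, 23], [18, 5, 29, 23, 30, 21, 26,
    28, 24, 14, 25, 20, 22], [19, 24, 30, 26, 27, 20, 15, 22, 23, 14, 16, 21], [20, 28, 0, 15, 19,
    27, 30, 25, 21, 18, 26], [21, 27, 18, 29, 17, 14, 22, 20, 24, 19], [22, 28, 17, 16, 19, 21, 23,
    15, 18], [23, 9, 12, 0, 19, 22, 4, 17], [24, 14, 18, 3, 15, 21, 16], [25, 11, 20, 18, 6, 1],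
    [26, 16, 3, 13, 20], [27, 13, 17, 15], [28, 2, 12], [29, 14], [30]]"

definition factors_31 :: "nat list list" where
  "factors_31 =
    [[31, 25, 28, 27, 29, 21, 30, 26, 24, 23, 20, 19, 8, 16, 18, 22, 14, 17, 10, 15, 7, 6, 9, 0, 2,
    12, 4, 11, 13, 3, 5, 1], [31, 27, 28, 19, 29, 20, 30, 26, 24, 23, 21, 7, 15, 16, 18, 17, 14, 8,
    9, 10, 22, 6, 3, 1, 5, 0, 12, 11, 2, 4, 13], [31, 26, 17, 16, 29, 18, 30, 25, 24, 23, 6, 10, 15,
    9, 21, 19, 14, 7, 8, 20, 22, 2, 12, 13, 5, 3, 4, 1, 11, 0], [31, 16, 17, 18, 29, 23, 30, 25, 24,
    22, 19, 10, 15, 6, 9, 21, 20, 14, 7, 8, 1, 5, 11, 13, 0, 3, 12, 2, 4], [31, 23, 24, 25, 28, 27,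
    30, 26, 15, 14, 22, 10, 18, 6, 20, 8, 9, 21, 7, 4, 13, 0, 11, 2, 1, 5, 3, 12], [31, 28, 24, 25,
    26, 27, 30, 5, 22, 19, 12, 15, 4, 13, 14, 20, 18, 11, 9, 7, 10, 3, 8, 2, 0, 1, 6], [31, 23, 27,
    22, 26, 25, 13, 17, 14, 11, 12, 15, 4, 19, 21, 5, 16, 8, 6, 2, 7, 1, 10, 9, 0, 3], [31, 22, 14,
    28, 27, 12, 13, 11, 17, 5, 16, 15, 21, 19, 4, 20, 7, 3, 1, 2, 10, 0, 6, 8, 9], [31, 15, 14, 29,
    11, 12, 5, 20, 13, 21, 3, 17, 18, 16, 19, 6, 0, 4, 1, 9, 8, 7, 10, 2], [31, 29, 28, 1, 0, 12,
    13, 20, 2, 17, 18, 16, 19, 21, 5, 11, 3, 10, 4, 9, 8, 6, 7], [31, 15, 0, 11, 2, 21, 3, 1, 19,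
    16, 22, 17, 18, 13, 4, 9, 12, 5, 6, 10, 7, 8], [31, 2, 18, 17, 14, 22, 20, 16, 5, 3, 1, 0, 10,
    8, 6, 9, 7, 12, 4, 13, 11], [31, 24, 25, 26, 27, 28, 29, 3, 4, 9, 10, 30, 23, 21, 19, 20, 16,
    18, 17, 14], [31, 9, 5, 4, 3, 7, 1, 6, 8, 2, 23, 30, 28, 29, 26, 21, 27, 20, 25], [31, 0, 8, 7,
    1, 6, 13, 3, 4, 29, 27, 30, 28, 23, 20, 24, 26, 21], [31, 7, 8, 6, 4, 1, 2, 3, 27, 29, 23, 30,
    19, 25, 28, 16, 24], [31, 0, 9, 2, 11, 10, 1, 25, 28, 29, 26, 30, 23, 16, 24, 19], [31, 12, 10,
    5, 11, 13, 26, 25, 18, 22, 24, 30, 29, 23, 27], [31, 11, 2, 0, 5, 24, 18, 22, 25, 27, 26, 30,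
    28, 23], [31, 0, 13, 12, 22, 24, 26, 23, 29, 27, 25, 30, 28], [31, 12, 23, 15, 17, 27, 24, 28,
    29, 26, 25, 30], [31, 30, 14, 15, 24, 27, 25, 28, 23, 29, 26], [31, 28, 26, 25, 17, 14, 24, 15,
    27, 29], [31, 16, 17, 18, 21, 19, 11, 12, 20], [31, 20, 21, 22, 14, 19, 9, 10], [31, 8, 16, 7,
    14, 19, 15], [31, 6, 15, 20, 14, 16], [31, 17, 13, 15, 18], [31, 22, 18, 5], [31, 21, 17], [31,
    22], [31]]"

lemma steiner_table_31: "steiner_table [14, 9, 8] 31 steiner_31"
  by code_simp

lemma factor_table_31: "factor_table [14, 9, 8] [12, 11, 9] 31 factors_31"
  by code_simp

lemma colors_within_31: "colors_within [14, 9, 8] [12, 11, 9] 31"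
  by code_simp

definition steiner_33 :: "nat list list" where
  "steiner_33 =
    [[0, 22, 26, 32, 17, 20, 29, 31, 24, 21, 30, 23, 27, 28, 19, 18, 25, 4, 15, 14, 5, 9, 1, 11, 8,
    16, 2, 12, 13, 6, 10, 7, 3], [1, 28, 23, 24, 32, 17, 21, 29, 16, 26, 20, 25, 18, 31, 19, 9, 6,
    13, 15, 11, 7, 0, 3, 4, 12, 10, 30, 2, 8, 27, 14, 5], [2, 16, 18, 21, 32, 30, 25, 24, 20, 31,
    19, 29, 17, 27, 3, 14, 4, 12, 10, 5, 23, 22, 9, 8, 0, 15, 1, 13, 7, 11, 6], [3, 19, 18, 31, 17,
    28, 27, 21, 25, 20, 22, 26, 24, 2, 7, 5, 4, 12, 10, 13, 1, 15, 11, 14, 9, 8, 30, 29, 6, 0], [4,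
    31, 16, 26, 23, 28, 32, 21, 22, 20, 25, 30, 6, 0, 2, 3, 13, 11, 12, 8, 1, 14, 7, 29, 9, 27, 15,
    5, 10], [5, 30, 27, 22, 19, 17, 29, 24, 26, 28, 25, 23, 10, 3, 9, 0, 2, 8, 16, 12, 15, 13, 7,
    14, 11, 6, 4, 1], [6, 20, 26, 22, 25, 19, 18, 27, 24, 28, 4, 1, 12, 11, 7, 23, 9, 21, 14, 10, 8,
    13, 15, 0, 5, 3, 2], [7, 16, 25, 28, 18, 29, 19, 32, 22, 8, 3, 11, 13, 6, 1, 15, 24, 23, 9, 4,
    5, 10, 12, 2, 0, 14], [8, 17, 27, 30, 32, 31, 20, 21, 7, 9, 19, 18, 14, 15, 5, 4, 0, 2, 6, 10,
    3, 1, 11, 13, 12], [9, 29, 32, 26, 30, 23, 31, 1, 8, 20, 5, 18, 0, 6, 14, 2, 7, 12, 3, 4, 10,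
    13, 15, 11], [10, 22, 31, 23, 18, 16, 15, 5, 14, 24, 2, 3, 11, 13, 19, 6, 1, 8, 7, 9, 0, 12, 4],
    [11, 28, 16, 27, 26, 13, 24, 7, 6, 1, 4, 10, 0, 17, 3, 15, 14, 12, 5, 8, 2, 9], [12, 17, 30, 23,
    21, 13, 6, 2, 3, 16, 4, 15, 5, 1, 9, 0, 11, 7, 14, 10, 8], [13, 21, 32, 11, 12, 1, 7, 4, 14, 3,
    10, 25, 24, 5, 6, 0, 2, 9, 8, 15], [14, 29, 22, 2, 10, 0, 8, 13, 16, 9, 6, 4, 3, 11, 5, 15, 12,
    1, 7], [15, 10, 20, 0, 1, 17, 8, 7, 12, 3, 5, 11, 2, 6, 14, 4, 9, 13], [16, 31, 27, 32, 26, 12,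
    14, 5, 30, 0, 20, 18, 29, 28, 24, 17, 19], [17, 28, 29, 15, 27, 30, 32, 11, 26, 25, 21, 18, 19,
    22, 16, 23], [18, 8, 9, 26, 29, 30, 31, 32, 21, 16, 17, 22, 23, 24, 25], [19, 28, 31, 26, 27,
    10, 30, 22, 23, 20, 17, 25, 21, 16], [20, 30, 32, 31, 29, 27, 16, 25, 19, 24, 21, 23, 22], [21,
    28, 6, 32, 29, 18, 17, 22, 25, 20, 19, 24], [22, 2, 27, 31, 19, 24, 21, 18, 17, 25, 20], [23, 7,
    28, 29, 19, 25, 26, 18, 20, 17], [24, 13, 28, 22, 26, 20, 16, 18, 21], [25, 17, 20, 23, 21, 19,
    22, 18], [26, 31, 24, 23, 32, 27, 30], [27, 32, 4, 1, 26, 28], [28, 16, 31, 30, 27], [29, 3, 32,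
    31], [30, 28, 26], [31, 29], [32]]"

definition factors_33 :: "nat list list" where
  "factors_33 =
    [[33, 31, 17, 30, 29, 27, 23, 18, 32, 26, 28, 21, 24, 20, 22, 19, 25, 16, 2, 7, 4, 6, 9, 3, 5,
    8, 12, 10, 11, 1, 15, 13, 14, 0], [33, 30, 29, 28, 17, 18, 24, 26, 32, 23, 19, 27, 21, 20, 22,
    16, 3, 8, 6, 5, 4, 7, 25, 9, 2, 11, 12, 1, 10, 14, 15, 0, 13], [33, 16, 31, 29, 24, 23, 20, 27,
    32, 26, 21, 22, 19, 28, 4, 2, 6, 25, 9, 8, 5, 18, 3, 7, 10, 1, 12, 11, 13, 0, 15, 14], [33, 24,
    28, 31, 22, 18, 23, 19, 32, 26, 27, 21, 20, 17, 9, 5, 3, 7, 2, 8, 6, 4, 25, 1, 11, 10, 12, 0,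
    14, 13, 15], [33, 16, 30, 20, 22, 19, 25, 23, 32, 26, 27, 21, 3, 8, 17, 9, 2, 7, 4, 5, 18, 6,
    15, 13, 14, 0, 12, 10, 11, 1], [33, 21, 30, 31, 22, 20, 25, 23, 32, 18, 26, 24, 7, 9, 5, 3, 19,
    6, 2, 8, 4, 14, 15, 0, 13, 11, 12, 1, 10], [33, 16, 29, 17, 26, 28, 25, 19, 32, 27, 20, 6, 7, 4,
    22, 5, 3, 8, 2, 9, 13, 0, 15, 14, 10, 1, 12, 11], [33, 17, 29, 31, 27, 28, 25, 26, 32, 2, 5, 4,
    21, 8, 9, 19, 7, 6, 3, 0, 14, 13, 15, 1, 11, 10, 12], [33, 16, 27, 24, 19, 28, 25, 30, 15, 21,
    23, 0, 13, 14, 10, 1, 11, 12, 9, 4, 5, 3, 8, 6, 7, 2], [33, 24, 31, 30, 18, 28, 25, 13, 15, 0,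
    11, 12, 20, 14, 10, 21, 1, 5, 9, 3, 4, 7, 8, 2, 6], [33, 16, 18, 30, 17, 29, 12, 14, 11, 10, 0,
    1, 22, 13, 15, 21, 4, 3, 9, 5, 6, 2, 8, 7], [33, 29, 17, 30, 18, 11, 20, 10, 1, 15, 22, 12, 0,
    13, 14, 3, 5, 4, 9, 2, 7, 6, 8], [33, 16, 31, 17, 10, 0, 20, 15, 14, 13, 1, 12, 22, 11, 7, 8, 2,
    6, 5, 9, 3, 4], [33, 29, 31, 1, 13, 24, 23, 11, 12, 15, 14, 0, 10, 6, 2, 8, 7, 4, 3, 9, 5], [33,
    16, 0, 24, 1, 14, 10, 15, 23, 11, 12, 13, 2, 7, 6, 8, 3, 5, 4, 9], [33, 14, 23, 12, 13, 24, 10,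
    11, 15, 1, 0, 8, 6, 7, 2, 9, 4, 5, 3], [33, 31, 28, 8, 6, 32, 29, 9, 7, 5, 27, 26, 30, 19, 22,
    21, 18, 23], [33, 27, 12, 1, 11, 32, 4, 10, 29, 26, 30, 19, 28, 25, 18, 22, 17], [33, 31, 26, 3,
    13, 32, 14, 15, 30, 19, 29, 25, 16, 22, 21, 18], [33, 29, 26, 2, 27, 32, 28, 19, 18, 20, 30, 17,
    16, 24, 22], [33, 30, 27, 28, 31, 32, 18, 17, 21, 20, 23, 25, 16, 19], [33, 0, 31, 28, 27, 17,
    21, 18, 29, 24, 23, 25, 16], [33, 26, 30, 31, 24, 16, 28, 18, 21, 17, 20, 25], [33, 29, 30, 16,
    23, 22, 17, 20, 24, 19, 21], [33, 26, 25, 27, 16, 23, 19, 20, 17, 24], [33, 22, 24, 17, 16, 18,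
    19, 23, 20], [33, 20, 23, 21, 31, 32, 28, 29], [33, 25, 22, 29, 31, 32, 28], [33, 24, 27, 26,
    31, 32], [33, 32, 27, 26, 31], [33, 28, 30, 26], [33, 29, 30], [33, 27], [33]]"

lemma steiner_table_33: "steiner_table [16, 10, 5, 2] 33 steiner_33"
  by code_simp

lemma factor_table_33: "factor_table [16, 10, 5, 2] [16, 10, 4, 4] 33 factors_33"
  by code_simp

lemma colors_within_33: "colors_within [16, 10, 5, 2] [16, 10, 4, 4] 33"
  by code_simp

definition steiner_37 :: "nat list list" where
  "steiner_37 =
    [[0, 23, 27, 28, 35, 31, 19, 36, 29, 33, 32, 25, 30, 34, 20, 24, 17, 16, 21, 6, 14, 18, 26, 1,
    15, 11, 22, 2, 3, 8, 12, 5, 10, 9, 13, 4, 7], [1, 20, 25, 22, 17, 27, 32, 28, 36, 21, 18, 33,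
    16, 26, 34, 13, 5, 11, 24, 2, 10, 4, 0, 19, 3, 14, 6, 8, 30, 29, 35, 7, 12, 15, 31, 9], [2, 18,
    29, 34, 17, 26, 25, 28, 31, 33, 36, 30, 19, 23, 21, 6, 3, 14, 1, 16, 24, 15, 22, 8, 7, 0, 9, 4,
    13, 10, 35, 11, 5, 32, 12], [3, 27, 32, 23, 31, 34, 16, 36, 29, 22, 35, 30, 33, 9, 24, 2, 26,
    21, 20, 12, 6, 17, 1, 19, 4, 0, 11, 14, 7, 5, 15, 8, 13, 10], [4, 33, 26, 34, 24, 20, 17, 28,
    32, 19, 25, 30, 18, 10, 16, 13, 9, 23, 1, 21, 8, 14, 6, 3, 11, 2, 15, 36, 12, 5, 7, 0, 31], [5,
    29, 16, 23, 35, 30, 36, 18, 28, 22, 26, 7, 1, 12, 21, 24, 19, 14, 8, 20, 27, 15, 25, 13, 6, 10,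
    0, 3, 4, 2, 9, 11], [6, 24, 16, 21, 22, 31, 28, 32, 18, 35, 8, 2, 14, 0, 25, 9, 10, 3, 7, 20, 4,
    1, 12, 5, 36, 11, 13, 34, 33, 15, 30], [7, 33, 30, 23, 21, 35, 18, 28, 29, 5, 22, 13, 25, 27,
    11, 17, 10, 6, 19, 2, 20, 14, 15, 9, 3, 1, 8, 4, 12, 0], [8, 32, 35, 30, 31, 21, 27, 36, 6, 18,
    17, 22, 26, 13, 19, 5, 4, 2, 20, 14, 1, 0, 11, 12, 9, 7, 3, 10, 15], [9, 29, 26, 19, 23, 34, 31,
    3, 27, 24, 12, 4, 6, 25, 13, 18, 22, 11, 17, 2, 10, 7, 15, 8, 0, 14, 5, 1], [10, 19, 34, 33, 24,
    28, 20, 4, 25, 11, 16, 1, 6, 7, 14, 18, 27, 26, 15, 9, 5, 2, 0, 13, 12, 8, 3], [11, 20, 22, 35,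
    17, 24, 15, 1, 10, 12, 7, 13, 27, 16, 0, 9, 23, 4, 3, 8, 6, 34, 2, 32, 14, 5], [12, 17, 29, 16,
    15, 13, 5, 9, 11, 27, 3, 26, 25, 24, 23, 21, 6, 14, 0, 8, 4, 1, 10, 7, 2], [13, 31, 20, 1, 12,
    7, 4, 15, 8, 11, 9, 27, 26, 25, 24, 5, 36, 2, 14, 6, 10, 0, 3, 29], [14, 32, 23, 21, 6, 2, 0,
    17, 5, 16, 10, 4, 1, 8, 7, 12, 3, 13, 15, 36, 9, 11, 33], [15, 12, 11, 22, 27, 13, 25, 18, 2, 0,
    21, 5, 19, 10, 7, 4, 9, 14, 3, 1, 6, 8], [16, 0, 4, 33, 10, 2, 35, 14, 11, 29, 34, 31, 36, 25,
    32, 27, 30, 19, 26, 22, 28], [17, 8, 34, 28, 14, 7, 33, 3, 32, 30, 9, 20, 31, 26, 29, 25, 23,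
    19, 36, 35], [18, 32, 33, 0, 15, 35, 9, 10, 36, 29, 34, 27, 31, 30, 19, 20, 28, 23, 26], [19,
    36, 5, 8, 30, 1, 7, 3, 15, 31, 35, 23, 28, 18, 16, 17, 29, 20], [20, 3, 31, 34, 5, 6, 8, 7, 17,
    32, 35, 22, 29, 18, 23, 30, 19], [21, 36, 4, 29, 15, 35, 12, 32, 24, 34, 33, 28, 31, 30, 26,
    22], [22, 32, 2, 9, 0, 30, 33, 34, 27, 20, 23, 28, 29, 16, 21], [23, 31, 36, 12, 11, 29, 28, 19,
    24, 22, 17, 20, 18, 25], [24, 12, 28, 13, 26, 21, 33, 23, 36, 30, 35, 34, 32], [25, 13, 5, 30,
    16, 28, 34, 17, 35, 31, 33, 23], [26, 10, 24, 33, 17, 32, 31, 29, 16, 21, 18], [27, 35, 18, 22,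
    16, 33, 32, 36, 28, 34], [28, 23, 25, 19, 21, 22, 18, 27, 16], [29, 1, 17, 20, 26, 22, 19, 13],
    [30, 18, 16, 24, 21, 20, 6], [31, 26, 21, 25, 1, 4], [32, 27, 11, 2, 24], [33, 6, 25, 14], [34,
    24, 27], [35, 17], [36]]"

definition factors_37 :: "nat list list" where
  "factors_37 =
    [[37, 29, 33, 32, 35, 24, 25, 36, 31, 26, 34, 30, 28, 23, 10, 18, 20, 21, 19, 8, 16, 11, 17, 9,
    12, 27, 22, 4, 5, 7, 0, 14, 15, 13, 2, 6, 3, 1], [37, 32, 33, 34, 35, 24, 23, 36, 31, 30, 28,
    25, 26, 9, 21, 17, 10, 18, 22, 8, 16, 11, 27, 19, 12, 20, 5, 1, 6, 15, 3, 13, 4, 14, 2, 0, 7],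
    [37, 31, 21, 20, 35, 19, 28, 36, 29, 22, 34, 30, 8, 16, 27, 26, 10, 18, 17, 9, 25, 24, 11, 23,
    12, 2, 7, 14, 6, 0, 3, 5, 4, 1, 13, 15], [37, 20, 21, 19, 22, 35, 28, 36, 29, 30, 34, 27, 23,
    18, 17, 16, 25, 12, 26, 8, 11, 24, 10, 9, 3, 6, 13, 1, 15, 2, 0, 5, 14, 7, 4], [37, 19, 18, 29,
    30, 33, 28, 36, 31, 32, 16, 12, 22, 24, 17, 26, 11, 8, 27, 23, 25, 9, 10, 7, 14, 1, 5, 6, 0, 15,
    13, 3, 4, 2], [37, 34, 30, 33, 29, 31, 32, 36, 28, 6, 14, 23, 16, 15, 17, 18, 22, 26, 25, 7, 13,
    27, 11, 9, 5, 8, 1, 4, 2, 3, 12, 10, 0], [37, 28, 32, 30, 33, 31, 29, 36, 15, 20, 14, 13, 21,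
    16, 23, 17, 22, 7, 27, 26, 6, 10, 8, 12, 4, 11, 5, 1, 0, 9, 2, 3], [37, 27, 34, 32, 33, 35, 31,
    14, 17, 16, 15, 26, 6, 20, 7, 18, 21, 13, 24, 25, 9, 0, 4, 2, 5, 1, 3, 10, 11, 12, 8], [37, 16,
    17, 34, 18, 29, 13, 15, 19, 25, 14, 20, 26, 6, 21, 22, 23, 7, 24, 8, 2, 3, 11, 4, 12, 9, 1, 0,
    5, 10], [37, 27, 35, 32, 17, 5, 19, 15, 14, 13, 7, 22, 24, 20, 18, 21, 25, 23, 1, 4, 0, 3, 2, 9,
    10, 11, 8, 6, 12], [37, 18, 16, 35, 4, 5, 2, 19, 25, 3, 6, 23, 24, 20, 26, 22, 21, 0, 13, 15, 9,
    7, 8, 14, 12, 10, 1, 11], [37, 17, 16, 1, 0, 5, 27, 24, 4, 3, 25, 23, 26, 20, 21, 19, 6, 15, 2,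
    10, 12, 11, 8, 7, 13, 9, 14], [37, 33, 0, 27, 1, 5, 2, 23, 24, 21, 4, 19, 22, 20, 26, 15, 3, 11,
    13, 9, 10, 12, 8, 7, 14, 6], [37, 2, 22, 21, 18, 27, 24, 25, 20, 3, 1, 0, 19, 5, 12, 10, 8, 14,
    13, 7, 11, 6, 4, 15, 9], [37, 28, 29, 31, 32, 33, 34, 35, 12, 3, 30, 11, 7, 36, 25, 24, 18, 20,
    26, 23, 22, 17, 21, 19], [37, 13, 11, 7, 9, 2, 10, 6, 4, 8, 3, 1, 34, 36, 33, 31, 30, 29, 32,
    26, 25, 35, 24], [37, 0, 11, 12, 7, 4, 10, 6, 9, 8, 3, 33, 35, 36, 34, 31, 28, 25, 30, 24, 26,
    32], [37, 1, 2, 9, 12, 7, 8, 3, 6, 4, 32, 33, 35, 36, 34, 20, 28, 29, 30, 23, 22], [37, 5, 0, 3,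
    9, 12, 6, 4, 8, 29, 30, 34, 35, 36, 22, 20, 28, 23, 33, 31], [37, 14, 13, 15, 0, 10, 1, 11, 31,
    32, 27, 21, 35, 36, 19, 34, 28, 29, 30], [37, 5, 1, 10, 4, 15, 13, 30, 31, 21, 32, 19, 35, 36,
    27, 29, 28, 33], [37, 14, 2, 1, 0, 15, 28, 19, 18, 30, 27, 33, 34, 36, 31, 32, 29], [37, 13, 5,
    2, 0, 19, 29, 32, 16, 33, 34, 35, 31, 36, 30, 28], [37, 15, 5, 14, 17, 28, 30, 29, 32, 16, 31,
    35, 33, 36, 34], [37, 14, 2, 18, 17, 29, 28, 16, 31, 33, 32, 35, 34, 36], [37, 36, 16, 18, 28,
    17, 29, 32, 30, 33, 34, 31, 35], [37, 35, 34, 31, 33, 28, 30, 29, 16, 32, 18, 17], [37, 24, 25,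
    26, 23, 14, 22, 20, 21, 27, 13], [37, 26, 12, 22, 21, 27, 23, 16, 11, 20], [37, 22, 10, 23, 17,
    9, 20, 19, 16], [37, 25, 24, 7, 19, 27, 20, 23], [37, 18, 24, 17, 26, 8, 21], [37, 6, 25, 19,
    17, 27], [37, 21, 18, 16, 26], [37, 15, 24, 18], [37, 22, 5], [37, 25], [37]]"

lemma steiner_table_37: "steiner_table [16, 12, 9] 37 steiner_37"
  by code_simp

lemma factor_table_37: "factor_table [16, 12, 9] [14, 13, 11] 37 factors_37"
  by code_simp

lemma colors_within_37: "colors_within [16, 12, 9] [14, 13, 11] 37"
  by code_simp

definition steiner_45 :: "nat list list" where
  "steiner_45 =
    [[0, 26, 44, 24, 23, 27, 25, 36, 42, 43, 30, 31, 37, 33, 35, 29, 39, 22, 38, 40, 28, 41, 17, 4,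
    3, 6, 1, 5, 20, 15, 10, 11, 34, 13, 32, 14, 7, 12, 18, 16, 19, 21, 8, 9, 2], [1, 36, 35, 37, 43,
    42, 24, 31, 34, 22, 30, 41, 38, 32, 44, 29, 28, 40, 27, 39, 25, 10, 33, 7, 21, 0, 19, 17, 16,
    11, 8, 14, 23, 9, 3, 2, 4, 13, 20, 18, 12, 6, 5, 15], [2, 40, 43, 29, 24, 37, 23, 39, 31, 33,
    38, 26, 25, 22, 28, 35, 41, 32, 30, 42, 15, 8, 6, 14, 13, 34, 16, 5, 20, 10, 19, 11, 27, 17, 1,
    7, 12, 9, 3, 18, 21, 4, 0], [3, 26, 32, 41, 43, 38, 44, 28, 27, 30, 34, 31, 42, 36, 25, 29, 39,
    37, 23, 33, 21, 0, 17, 4, 11, 10, 18, 12, 14, 5, 22, 13, 1, 16, 20, 8, 19, 2, 6, 15, 7, 9], [4,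
    38, 39, 25, 40, 30, 24, 36, 34, 22, 33, 28, 41, 32, 35, 42, 29, 44, 13, 0, 10, 7, 3, 31, 15, 20,
    9, 27, 17, 14, 12, 18, 11, 1, 5, 6, 8, 16, 19, 2, 21], [5, 30, 33, 25, 23, 34, 42, 40, 44, 41,
    37, 24, 39, 36, 22, 35, 28, 19, 9, 16, 8, 31, 0, 21, 2, 6, 26, 3, 7, 10, 20, 18, 15, 4, 17, 12,
    14, 11, 1, 13], [6, 26, 22, 29, 33, 38, 35, 37, 36, 27, 40, 23, 43, 28, 44, 34, 8, 17, 2, 0, 7,
    15, 19, 9, 5, 32, 31, 10, 21, 12, 14, 13, 11, 4, 16, 3, 1, 18, 20], [7, 39, 35, 41, 28, 42, 32,
    38, 34, 31, 40, 44, 30, 27, 22, 21, 29, 1, 4, 6, 20, 11, 23, 19, 16, 13, 5, 15, 9, 0, 2, 14, 8,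
    17, 10, 12, 3, 18], [8, 24, 35, 34, 32, 30, 28, 36, 26, 43, 37, 44, 41, 29, 6, 2, 9, 5, 16, 33,
    14, 21, 13, 1, 12, 27, 11, 10, 15, 18, 3, 7, 4, 20, 0, 17, 19], [9, 25, 22, 33, 36, 37, 31, 32,
    41, 26, 38, 42, 40, 11, 5, 8, 10, 18, 28, 27, 6, 4, 15, 16, 12, 1, 7, 13, 14, 19, 2, 21, 17, 20,
    0, 3], [10, 26, 36, 23, 44, 38, 42, 27, 39, 37, 40, 43, 1, 13, 4, 9, 11, 17, 3, 32, 0, 2, 29, 6,
    5, 8, 12, 19, 15, 18, 20, 7, 16, 21, 14], [11, 43, 41, 39, 40, 44, 37, 23, 29, 25, 35, 9, 18,
    32, 20, 10, 3, 7, 19, 1, 0, 24, 2, 8, 21, 4, 17, 6, 14, 15, 13, 5, 12, 16], [12, 28, 29, 39, 25,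
    44, 22, 26, 23, 27, 18, 20, 31, 16, 19, 21, 13, 14, 3, 24, 8, 9, 4, 6, 10, 0, 2, 15, 5, 1, 7,
    11, 17], [13, 40, 35, 27, 31, 42, 43, 24, 39, 4, 10, 20, 29, 2, 16, 12, 25, 8, 17, 7, 0, 3, 15,
    9, 6, 1, 21, 14, 11, 18, 19, 5], [14, 23, 43, 42, 27, 24, 34, 26, 30, 15, 19, 2, 21, 18, 8, 12,
    22, 3, 1, 4, 20, 0, 6, 9, 7, 11, 13, 5, 17, 16, 10], [15, 33, 24, 30, 41, 43, 32, 2, 14, 17, 26,
    25, 6, 4, 0, 18, 9, 21, 16, 7, 13, 8, 5, 10, 12, 11, 19, 3, 20, 1], [16, 30, 34, 35, 38, 37, 23,
    22, 5, 12, 8, 13, 2, 1, 17, 7, 9, 15, 18, 19, 3, 21, 20, 0, 6, 4, 10, 14, 11], [17, 33, 36, 26,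
    38, 0, 6, 15, 3, 20, 10, 1, 34, 16, 13, 4, 18, 29, 2, 19, 11, 21, 5, 7, 9, 14, 8, 12], [18, 25,
    31, 24, 12, 11, 21, 19, 9, 14, 32, 3, 15, 20, 28, 17, 16, 4, 5, 8, 0, 10, 1, 2, 13, 6, 7], [19,
    33, 31, 5, 34, 14, 18, 12, 1, 6, 11, 7, 21, 2, 20, 23, 16, 17, 10, 9, 3, 0, 15, 4, 13, 8], [20,
    36, 32, 12, 13, 11, 17, 7, 0, 4, 2, 18, 22, 19, 14, 5, 21, 3, 16, 1, 10, 8, 9, 15, 6], [21, 7,
    3, 18, 1, 14, 12, 5, 8, 33, 19, 15, 30, 6, 11, 20, 16, 17, 13, 9, 0, 2, 10, 4], [22, 16, 41, 40,
    42, 38, 36, 37, 14, 44, 20, 3, 43, 39, 28, 29, 27, 35, 25, 24, 26, 34, 31], [23, 38, 36, 37, 39,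
    42, 7, 40, 41, 35, 1, 19, 32, 25, 26, 24, 27, 30, 31, 28, 44, 43], [24, 43, 39, 37, 35, 44, 36,
    12, 11, 42, 40, 28, 30, 27, 23, 26, 34, 22, 33, 25, 29], [25, 15, 42, 41, 13, 35, 37, 44, 39,
    38, 30, 23, 31, 34, 33, 22, 28, 27, 24, 32], [26, 40, 43, 35, 41, 5, 38, 44, 36, 29, 34, 23, 32,
    24, 27, 30, 22, 28, 33], [27, 9, 43, 44, 4, 41, 8, 2, 36, 35, 24, 22, 23, 26, 32, 25, 29, 30],
    [28, 39, 37, 38, 18, 40, 44, 24, 22, 30, 31, 29, 33, 25, 23, 26, 34], [29, 38, 40, 10, 36, 17,
    26, 33, 22, 30, 28, 31, 42, 41, 27, 24], [30, 43, 42, 21, 39, 25, 24, 28, 29, 34, 23, 26, 32,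
    31, 27], [31, 6, 35, 42, 33, 39, 25, 28, 36, 29, 23, 34, 30, 22], [32, 43, 0, 23, 37, 36, 26,
    40, 39, 27, 30, 33, 25], [33, 41, 31, 29, 38, 37, 25, 28, 34, 24, 32, 26], [34, 37, 26, 35, 25,
    30, 24, 33, 31, 22, 28], [35, 27, 34, 43, 22, 41, 40, 44, 38, 42], [36, 32, 41, 31, 44, 38, 43,
    42, 40], [37, 33, 42, 43, 44, 39, 40, 41], [38, 44, 42, 36, 40, 35, 39], [39, 32, 43, 37, 41,
    38], [40, 35, 38, 37, 36], [41, 29, 39, 37], [42, 36, 35], [43, 23], [44]]"

definition factors_45 :: "nat list list" where
  "factors_45 =
    [[45, 43, 23, 42, 41, 39, 38, 40, 25, 24, 26, 44, 35, 36, 37, 31, 28, 29, 30, 32, 33, 27, 9, 8,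
    34, 22, 10, 6, 5, 2, 4, 7, 3, 11, 12, 1, 20, 21, 18, 19, 0, 17, 13, 16, 15, 14], [45, 42, 41,
    40, 23, 39, 24, 38, 32, 27, 31, 44, 25, 28, 26, 33, 30, 35, 36, 37, 29, 8, 7, 11, 34, 22, 2, 9,
    5, 3, 4, 6, 10, 1, 12, 19, 17, 21, 16, 14, 0, 15, 13, 20, 18], [45, 22, 43, 41, 40, 37, 39, 30,
    25, 32, 27, 44, 36, 29, 38, 28, 31, 35, 26, 33, 5, 34, 7, 4, 8, 24, 3, 10, 2, 11, 9, 6, 21, 13,
    18, 19, 0, 20, 1, 16, 17, 15, 14, 12], [45, 33, 40, 43, 38, 24, 29, 39, 25, 36, 37, 44, 35, 30,
    27, 26, 28, 32, 31, 7, 5, 4, 23, 34, 8, 6, 3, 10, 9, 11, 2, 13, 21, 17, 18, 19, 15, 20, 1, 12,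
    14, 0, 16], [45, 22, 42, 39, 36, 28, 30, 35, 25, 31, 34, 44, 32, 26, 37, 29, 27, 38, 24, 4, 23,
    2, 7, 9, 10, 8, 11, 6, 5, 3, 20, 14, 16, 12, 15, 21, 19, 18, 0, 1, 17, 13], [45, 24, 42, 37, 43,
    31, 27, 28, 34, 38, 36, 44, 35, 32, 26, 29, 30, 6, 2, 3, 11, 9, 10, 25, 33, 8, 5, 4, 7, 14, 20,
    15, 16, 17, 1, 21, 12, 18, 0, 13, 19], [45, 22, 41, 23, 29, 30, 32, 28, 27, 37, 35, 44, 36, 31,
    34, 26, 4, 6, 2, 8, 33, 25, 7, 11, 9, 3, 10, 5, 19, 15, 13, 0, 12, 18, 17, 21, 14, 20, 16, 1],
    [45, 23, 41, 43, 28, 29, 30, 32, 27, 31, 36, 44, 25, 35, 34, 3, 10, 5, 6, 11, 7, 26, 4, 33, 2,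
    8, 9, 15, 19, 1, 13, 16, 14, 18, 20, 21, 17, 12, 0], [45, 22, 42, 40, 30, 32, 29, 28, 43, 34,
    27, 44, 31, 35, 26, 3, 9, 10, 5, 11, 2, 7, 6, 8, 33, 4, 18, 16, 14, 15, 13, 0, 12, 19, 20, 21,
    1, 17], [45, 40, 39, 42, 35, 26, 38, 36, 33, 34, 37, 44, 25, 2, 11, 10, 9, 6, 3, 4, 31, 5, 27,
    7, 8, 16, 18, 0, 1, 14, 17, 15, 13, 19, 12, 21, 20], [45, 22, 24, 23, 35, 34, 37, 38, 33, 41,
    36, 44, 21, 17, 16, 13, 14, 15, 19, 12, 20, 28, 32, 18, 3, 0, 9, 11, 1, 6, 8, 4, 5, 10, 2, 7],
    [45, 23, 41, 42, 33, 24, 37, 43, 34, 38, 36, 20, 19, 18, 12, 15, 26, 13, 16, 17, 29, 14, 21, 0,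
    3, 11, 10, 7, 8, 2, 9, 1, 5, 6, 4], [45, 22, 33, 41, 34, 43, 40, 38, 39, 37, 18, 21, 19, 17, 26,
    14, 31, 15, 0, 1, 16, 20, 11, 4, 12, 8, 9, 13, 6, 2, 7, 3, 10, 5], [45, 24, 42, 26, 40, 38, 33,
    43, 39, 17, 20, 21, 19, 1, 18, 27, 0, 29, 16, 15, 14, 4, 11, 10, 9, 2, 12, 13, 7, 8, 6, 5, 3],
    [45, 22, 41, 39, 25, 43, 40, 23, 16, 0, 20, 21, 19, 1, 30, 13, 31, 12, 18, 17, 10, 5, 6, 14, 8,
    9, 4, 15, 2, 7, 3, 11], [45, 23, 25, 39, 40, 24, 43, 0, 18, 1, 20, 21, 13, 12, 17, 32, 30, 19,
    16, 5, 10, 8, 6, 11, 3, 9, 14, 4, 2, 7, 15], [45, 22, 42, 39, 25, 40, 13, 15, 14, 18, 12, 20, 1,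
    19, 21, 0, 27, 29, 17, 6, 7, 5, 10, 11, 16, 3, 9, 4, 8, 2], [45, 23, 24, 42, 41, 15, 13, 0, 1,
    18, 12, 21, 32, 19, 14, 20, 31, 6, 17, 4, 7, 3, 2, 5, 10, 16, 8, 11, 9], [45, 22, 41, 24, 14,
    12, 17, 0, 20, 21, 16, 28, 1, 15, 29, 13, 9, 7, 2, 3, 4, 5, 11, 6, 10, 19, 18, 8], [45, 23, 42,
    1, 16, 13, 15, 17, 0, 20, 30, 14, 21, 12, 27, 7, 9, 5, 2, 6, 4, 3, 8, 11, 18, 19, 10], [45, 22,
    12, 14, 15, 16, 0, 28, 17, 1, 18, 19, 13, 30, 2, 8, 3, 20, 5, 7, 10, 11, 6, 9, 4, 21], [45, 19,
    28, 32, 14, 13, 16, 0, 18, 12, 17, 1, 15, 8, 2, 21, 4, 20, 10, 7, 5, 3, 11, 9, 6], [45, 35, 42,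
    41, 43, 40, 11, 39, 36, 10, 38, 37, 28, 23, 27, 44, 30, 33, 32, 31, 25, 22, 34, 29], [45, 41,
    42, 38, 43, 36, 9, 39, 37, 40, 1, 23, 22, 24, 27, 44, 31, 29, 26, 30, 25, 33, 32], [45, 35, 37,
    39, 8, 6, 40, 38, 36, 12, 22, 24, 43, 25, 31, 44, 28, 29, 27, 30, 26, 33], [45, 3, 5, 38, 36, 7,
    40, 37, 39, 25, 33, 28, 24, 43, 30, 44, 32, 31, 27, 29, 26], [45, 4, 35, 40, 16, 39, 2, 36, 24,
    25, 23, 41, 29, 27, 31, 44, 28, 32, 42, 30], [45, 37, 35, 38, 36, 17, 19, 33, 34, 41, 32, 23,
    22, 30, 42, 44, 29, 31, 27], [45, 14, 15, 18, 39, 40, 29, 28, 32, 33, 42, 43, 41, 34, 23, 44,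
    24, 22], [45, 37, 20, 21, 38, 27, 29, 26, 42, 22, 25, 43, 24, 34, 23, 44, 41], [45, 13, 44, 35,
    30, 27, 34, 23, 41, 24, 22, 43, 26, 28, 25, 42], [45, 35, 44, 32, 31, 33, 34, 26, 42, 25, 41,
    43, 24, 22, 23], [45, 0, 31, 30, 22, 28, 24, 23, 26, 25, 42, 43, 41, 34], [45, 34, 32, 42, 22,
    25, 26, 23, 33, 24, 41, 28, 43], [45, 26, 35, 37, 36, 38, 40, 39, 41, 42, 43, 44], [45, 44, 43,
    38, 41, 42, 40, 39, 37, 36, 35], [45, 36, 37, 29, 39, 38, 40, 31, 30, 25], [45, 35, 40, 38, 30,
    29, 26, 39, 31], [45, 34, 33, 27, 32, 39, 40, 28], [45, 35, 28, 37, 36, 32, 39], [45, 37, 36,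
    34, 27, 24], [45, 22, 35, 23, 36], [45, 33, 35, 38], [45, 38, 40], [45, 37], [45]]"

lemma steiner_table_45: "steiner_table [22, 13, 6, 4] 45 steiner_45"
  by code_simp

text \<open>The new classes follow the order of the old colors, hence 2 before 10. The mixed edges
  number 22 * 22 + 13 * 12 + 6 * 2 + 4 * 10 = 692, which is also the number of pairs of new points
  of different colors.\<close>

lemma factor_table_45: "factor_table [22, 13, 6, 4] [22, 12, 2, 10] 45 factors_45"
  by code_simp

lemma colors_within_45: "colors_within [22, 13, 6, 4] [22, 12, 2, 10] 45"
  by code_simp

definition steiner_49 :: "nat list list" where
  "steiner_49 =
    [[0, 24, 47, 28, 26, 37, 40, 46, 27, 32, 25, 34, 30, 36, 48, 29, 45, 42, 44, 35, 38, 39, 41, 43,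
    1, 10, 4, 8, 3, 15, 12, 33, 9, 31, 11, 19, 13, 5, 20, 21, 6, 22, 17, 23, 18, 16, 7, 2, 14], [1,
    32, 42, 46, 41, 30, 40, 44, 25, 48, 37, 29, 38, 45, 47, 33, 39, 36, 43, 31, 27, 34, 35, 0, 9,
    28, 21, 26, 12, 6, 20, 2, 16, 22, 23, 18, 11, 13, 17, 7, 5, 3, 19, 8, 14, 4, 15, 10], [2, 37,
    42, 40, 29, 24, 43, 46, 36, 27, 33, 44, 41, 38, 48, 45, 31, 39, 28, 26, 25, 30, 7, 22, 21, 11,
    20, 6, 23, 18, 1, 12, 35, 34, 10, 3, 15, 19, 5, 14, 4, 8, 13, 17, 9, 0, 16], [3, 36, 47, 45, 35,
    38, 39, 40, 32, 34, 43, 29, 44, 31, 26, 33, 41, 46, 25, 48, 27, 30, 21, 17, 23, 0, 14, 24, 16,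
    11, 18, 12, 7, 4, 2, 8, 9, 10, 19, 1, 13, 15, 6, 20, 5, 22], [4, 43, 48, 29, 37, 44, 38, 33, 24,
    45, 40, 34, 35, 25, 39, 30, 27, 28, 47, 41, 12, 17, 0, 20, 21, 7, 19, 32, 31, 11, 15, 16, 3, 8,
    10, 18, 14, 23, 2, 5, 9, 13, 1, 22, 6], [5, 31, 48, 46, 45, 32, 30, 36, 27, 34, 33, 42, 38, 25,
    44, 26, 35, 29, 39, 28, 18, 20, 13, 24, 22, 11, 6, 10, 15, 14, 21, 12, 0, 17, 23, 2, 1, 16, 4,
    19, 9, 8, 3, 7], [6, 34, 33, 41, 43, 24, 39, 46, 32, 35, 28, 36, 38, 27, 44, 47, 42, 37, 11, 26,
    25, 19, 16, 2, 1, 5, 14, 8, 7, 15, 17, 23, 18, 12, 0, 9, 22, 10, 20, 3, 13, 21, 4], [7, 45, 47,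
    27, 28, 43, 42, 36, 37, 39, 41, 30, 25, 33, 44, 38, 31, 2, 19, 32, 10, 11, 4, 18, 23, 26, 20, 6,
    3, 14, 15, 22, 16, 1, 17, 13, 12, 21, 8, 0, 9, 5], [8, 31, 39, 48, 42, 28, 26, 25, 30, 34, 40,
    29, 41, 36, 32, 47, 35, 15, 14, 0, 13, 19, 16, 9, 22, 6, 17, 24, 21, 4, 3, 10, 18, 20, 12, 2, 1,
    7, 5, 23, 11], [9, 34, 29, 28, 35, 27, 30, 26, 33, 42, 48, 43, 37, 24, 36, 22, 1, 16, 14, 12,
    11, 15, 8, 0, 17, 10, 13, 23, 21, 40, 3, 38, 6, 18, 20, 4, 5, 2, 7, 19], [10, 44, 41, 47, 37,
    45, 46, 31, 28, 26, 24, 29, 30, 42, 20, 0, 19, 7, 18, 21, 22, 17, 5, 35, 9, 33, 2, 14, 4, 8, 3,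
    12, 23, 6, 11, 15, 16, 13, 1], [11, 26, 25, 43, 40, 38, 35, 41, 31, 47, 46, 36, 45, 6, 13, 12,
    2, 7, 9, 5, 19, 3, 4, 0, 17, 22, 1, 16, 42, 15, 18, 39, 14, 10, 23, 21, 20, 8], [12, 31, 35, 46,
    47, 44, 37, 45, 25, 48, 40, 38, 4, 20, 11, 32, 9, 1, 0, 13, 27, 2, 3, 14, 5, 18, 23, 6, 22, 10,
    8, 7, 17, 19, 15, 16, 21], [13, 33, 41, 32, 24, 48, 37, 30, 40, 39, 26, 17, 11, 23, 5, 8, 34,
    20, 12, 16, 14, 29, 9, 0, 19, 1, 22, 21, 15, 7, 3, 2, 4, 6, 10, 18], [14, 24, 25, 28, 47, 46,
    42, 30, 31, 44, 15, 16, 8, 9, 17, 3, 21, 22, 6, 13, 5, 12, 7, 10, 39, 38, 4, 2, 20, 11, 23, 1,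
    19, 18, 0], [15, 27, 32, 26, 28, 39, 42, 43, 48, 14, 8, 18, 16, 19, 0, 9, 36, 17, 5, 4, 6, 31,
    7, 2, 20, 11, 13, 21, 22, 3, 10, 12, 1, 23], [16, 40, 43, 24, 29, 41, 44, 34, 19, 14, 9, 15, 6,
    20, 8, 3, 13, 1, 23, 4, 37, 36, 11, 7, 17, 21, 5, 18, 22, 0, 10, 12, 2], [17, 29, 47, 48, 43,
    37, 46, 13, 4, 3, 30, 14, 18, 27, 10, 15, 9, 8, 11, 6, 22, 5, 1, 16, 7, 0, 21, 12, 2, 23, 19,
    20], [18, 34, 45, 32, 46, 24, 23, 5, 15, 35, 10, 17, 7, 2, 21, 3, 19, 27, 1, 12, 6, 4, 8, 11, 9,
    16, 0, 20, 22, 14, 13], [19, 36, 38, 33, 32, 16, 7, 10, 6, 15, 8, 4, 11, 23, 22, 18, 0, 20, 13,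
    21, 2, 42, 3, 40, 1, 5, 12, 14, 17, 9], [20, 34, 35, 40, 10, 12, 5, 4, 2, 16, 13, 1, 37, 7, 21,
    22, 19, 32, 0, 15, 23, 8, 14, 9, 6, 18, 3, 11, 17], [21, 45, 33, 31, 3, 2, 1, 4, 10, 14, 24, 18,
    23, 20, 5, 8, 9, 19, 0, 13, 16, 15, 17, 7, 22, 11, 6, 12], [22, 28, 9, 2, 27, 26, 23, 5, 10, 14,
    8, 19, 1, 20, 11, 17, 7, 13, 12, 0, 6, 15, 16, 21, 18, 4, 3], [23, 18, 29, 13, 3, 22, 25, 2, 7,
    19, 21, 16, 1, 9, 6, 12, 5, 20, 4, 10, 0, 14, 11, 17, 8, 15], [24, 38, 42, 39, 5, 48, 3, 21, 40,
    46, 41, 8, 43, 47, 25, 27, 32, 34, 26, 36, 45, 44, 33, 37, 29], [25, 6, 45, 41, 23, 47, 46, 43,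
    42, 48, 39, 40, 44, 24, 35, 36, 28, 33, 32, 37, 27, 31, 30, 34], [26, 22, 1, 39, 44, 38, 7, 41,
    40, 48, 47, 43, 31, 29, 34, 33, 24, 37, 30, 46, 45, 36, 35], [27, 46, 43, 17, 44, 12, 48, 47,
    18, 42, 40, 41, 24, 37, 38, 36, 29, 31, 25, 28, 34, 33], [28, 45, 48, 39, 38, 47, 43, 40, 44,
    42, 32, 31, 35, 25, 37, 34, 36, 29, 27, 33, 30], [29, 46, 42, 47, 40, 13, 44, 41, 38, 37, 26,
    33, 36, 31, 27, 35, 28, 30, 32, 24], [30, 40, 41, 43, 38, 42, 45, 39, 34, 37, 31, 32, 35, 33,
    26, 36, 29, 25, 28], [31, 4, 0, 45, 47, 15, 48, 26, 28, 30, 43, 29, 41, 27, 34, 25, 35, 37],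
    [32, 39, 42, 45, 48, 20, 28, 33, 24, 30, 34, 25, 46, 35, 44, 29, 36], [33, 44, 10, 38, 45, 36,
    32, 29, 26, 25, 30, 34, 37, 24, 28, 27], [34, 2, 39, 46, 30, 36, 26, 24, 32, 28, 33, 31, 37, 27,
    25], [35, 46, 41, 43, 25, 28, 37, 30, 38, 29, 32, 36, 31, 26], [36, 16, 33, 34, 25, 29, 27, 24,
    28, 30, 35, 26, 32], [37, 29, 30, 27, 35, 28, 26, 25, 33, 34, 24, 31], [38, 14, 9, 27, 44, 35,
    42, 48, 47, 46, 45], [39, 47, 45, 11, 44, 43, 41, 48, 40, 46], [40, 46, 19, 45, 48, 43, 41, 39,
    44], [41, 48, 31, 47, 39, 40, 44, 42], [42, 46, 38, 47, 43, 45, 41], [43, 39, 40, 42, 48, 47],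
    [44, 24, 32, 41, 40], [45, 26, 42, 38], [46, 38, 39], [47, 43], [48]]"

definition factors_49 :: "nat list list" where
  "factors_49 =
    [[49, 47, 25, 46, 45, 43, 42, 44, 27, 26, 33, 28, 48, 39, 40, 36, 35, 29, 30, 32, 38, 31, 41,
    34, 2, 6, 7, 9, 8, 3, 24, 11, 5, 37, 10, 4, 19, 21, 15, 20, 1, 18, 17, 14, 12, 13, 16, 23, 0,
    22], [49, 46, 45, 44, 25, 43, 26, 42, 40, 35, 31, 27, 48, 30, 41, 28, 38, 39, 33, 32, 34, 29,
    36, 24, 5, 4, 8, 11, 10, 7, 2, 9, 3, 37, 6, 17, 20, 19, 18, 15, 12, 13, 16, 1, 21, 14, 22, 23,
    0], [49, 24, 47, 45, 44, 41, 43, 39, 27, 33, 31, 30, 48, 38, 36, 32, 35, 40, 29, 28, 34, 42, 4,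
    3, 10, 5, 7, 2, 26, 9, 11, 8, 6, 37, 21, 19, 1, 16, 18, 14, 15, 13, 17, 20, 12, 0, 22, 23], [49,
    36, 44, 47, 42, 26, 43, 34, 27, 28, 38, 39, 48, 32, 31, 40, 41, 33, 30, 35, 29, 25, 4, 3, 10, 2,
    37, 5, 6, 8, 11, 9, 7, 23, 17, 18, 1, 19, 20, 21, 0, 15, 16, 22, 14, 12, 13], [49, 24, 46, 43,
    40, 41, 32, 34, 42, 33, 38, 39, 48, 28, 27, 29, 30, 37, 31, 35, 26, 11, 2, 4, 3, 25, 9, 8, 7, 6,
    5, 10, 22, 23, 20, 0, 16, 19, 18, 1, 21, 17, 15, 13, 14, 12], [49, 26, 46, 41, 42, 47, 29, 38,
    31, 37, 40, 39, 48, 33, 35, 34, 32, 28, 30, 5, 2, 6, 3, 4, 7, 8, 27, 10, 36, 11, 9, 20, 22, 23,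
    19, 0, 21, 1, 18, 16, 15, 17, 12, 13, 14], [49, 24, 45, 25, 30, 32, 33, 34, 31, 29, 40, 41, 48,
    37, 39, 35, 38, 28, 27, 10, 8, 2, 9, 6, 11, 3, 4, 7, 36, 5, 14, 1, 22, 23, 20, 0, 19, 21, 13,
    12, 18, 17, 15, 16], [49, 25, 45, 29, 47, 32, 27, 34, 30, 33, 35, 38, 48, 37, 40, 39, 31, 28, 9,
    36, 7, 5, 11, 6, 10, 3, 4, 2, 8, 13, 0, 21, 12, 23, 22, 14, 20, 18, 19, 1, 16, 17, 15], [49, 24,
    46, 44, 47, 35, 33, 31, 29, 34, 32, 30, 48, 39, 37, 38, 36, 8, 11, 6, 10, 5, 4, 28, 2, 9, 7, 3,
    1, 14, 12, 22, 21, 23, 0, 19, 20, 18, 13, 15, 16, 17], [49, 44, 46, 30, 47, 29, 33, 31, 36, 34,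
    38, 27, 48, 32, 37, 3, 7, 9, 11, 6, 8, 10, 5, 35, 28, 4, 2, 16, 12, 13, 14, 22, 15, 23, 17, 0,
    1, 21, 20, 19, 18], [49, 24, 43, 25, 45, 37, 26, 40, 41, 42, 36, 38, 48, 39, 18, 28, 14, 31, 21,
    16, 12, 15, 20, 19, 13, 17, 0, 7, 6, 11, 8, 1, 22, 23, 10, 9, 5, 4, 3, 2], [49, 25, 43, 26, 45,
    38, 37, 36, 39, 42, 41, 40, 48, 17, 21, 30, 19, 12, 20, 16, 14, 15, 18, 35, 13, 9, 8, 10, 4, 11,
    7, 6, 5, 23, 22, 0, 3, 2, 1], [49, 24, 46, 35, 45, 39, 37, 44, 41, 36, 26, 40, 21, 18, 17, 14,
    20, 12, 29, 16, 19, 13, 34, 15, 11, 10, 0, 9, 6, 5, 7, 22, 8, 23, 4, 2, 1, 3], [49, 44, 46, 37,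
    42, 28, 36, 40, 26, 45, 41, 20, 16, 29, 15, 13, 14, 18, 21, 32, 17, 12, 19, 2, 9, 3, 6, 7, 11,
    10, 8, 22, 0, 23, 1, 5, 4], [49, 24, 41, 25, 42, 27, 28, 43, 36, 47, 22, 23, 1, 18, 0, 19, 17,
    20, 16, 32, 21, 35, 15, 11, 14, 13, 9, 10, 2, 12, 3, 8, 7, 6, 4, 5], [49, 25, 47, 26, 28, 44,
    42, 43, 27, 19, 22, 16, 20, 17, 18, 34, 23, 21, 1, 0, 32, 10, 15, 9, 3, 13, 2, 12, 4, 14, 11, 8,
    5, 7, 6], [49, 24, 46, 43, 47, 27, 42, 44, 16, 30, 22, 0, 18, 23, 20, 17, 1, 21, 19, 34, 12, 13,
    11, 5, 14, 3, 9, 15, 4, 2, 10, 8, 6, 7], [49, 45, 46, 43, 44, 27, 26, 1, 33, 0, 22, 19, 21, 23,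
    30, 18, 20, 17, 16, 3, 4, 5, 15, 12, 13, 11, 10, 2, 14, 6, 7, 9, 8], [49, 24, 25, 47, 44, 43, 0,
    31, 13, 29, 23, 15, 22, 1, 12, 14, 20, 21, 4, 16, 7, 17, 10, 6, 5, 11, 19, 3, 2, 18, 8, 9], [49,
    26, 45, 47, 25, 15, 20, 21, 1, 14, 22, 13, 31, 34, 12, 23, 0, 5, 3, 4, 2, 17, 8, 16, 6, 11, 7,
    19, 9, 18, 10], [49, 24, 46, 45, 14, 19, 23, 12, 1, 13, 0, 18, 31, 35, 15, 22, 8, 5, 17, 7, 2,
    16, 20, 9, 6, 4, 3, 10, 21, 11], [49, 25, 46, 13, 29, 12, 33, 15, 1, 19, 22, 23, 0, 14, 18, 6,
    2, 16, 8, 3, 17, 4, 7, 9, 5, 20, 11, 10, 21], [49, 24, 12, 0, 33, 30, 16, 17, 15, 13, 14, 23,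
    22, 1, 18, 6, 8, 21, 5, 4, 3, 2, 7, 10, 9, 19, 11, 20], [49, 23, 17, 15, 13, 33, 0, 1, 12, 22,
    16, 32, 14, 7, 18, 2, 10, 4, 9, 8, 3, 5, 6, 11, 21, 20, 19], [49, 44, 46, 45, 47, 9, 48, 7, 6,
    10, 8, 11, 38, 34, 40, 32, 31, 39, 43, 30, 42, 41, 35, 29, 37, 33], [49, 45, 46, 42, 47, 14, 48,
    13, 15, 1, 12, 26, 27, 34, 38, 40, 35, 39, 41, 37, 32, 43, 24, 25, 36], [49, 44, 41, 42, 47, 19,
    48, 5, 18, 20, 37, 35, 43, 31, 32, 28, 38, 27, 34, 39, 40, 26, 24, 25], [49, 40, 41, 21, 47, 17,
    48, 16, 23, 35, 37, 42, 36, 38, 32, 34, 28, 43, 27, 39, 25, 26, 24], [49, 44, 46, 39, 45, 22,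
    48, 38, 36, 25, 37, 43, 30, 31, 24, 32, 35, 34, 29, 27, 28, 26], [49, 45, 4, 39, 46, 38, 48, 24,
    43, 29, 26, 33, 36, 30, 35, 40, 31, 28, 34, 32, 27], [49, 40, 44, 2, 3, 43, 25, 42, 35, 39, 36,
    38, 31, 33, 30, 37, 41, 32, 27, 28], [49, 0, 44, 46, 45, 41, 29, 36, 37, 25, 42, 33, 38, 26, 43,
    24, 35, 34, 32], [49, 43, 47, 46, 42, 36, 38, 25, 28, 27, 37, 40, 41, 24, 26, 30, 33, 29], [49,
    45, 47, 29, 38, 24, 42, 39, 41, 40, 25, 33, 26, 27, 31, 30, 34], [49, 44, 43, 24, 33, 30, 42,
    26, 41, 39, 27, 40, 25, 28, 29, 31], [49, 27, 41, 25, 28, 24, 40, 42, 26, 39, 29, 36, 33, 31,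
    30], [49, 44, 46, 45, 47, 33, 32, 34, 31, 28, 30, 48, 39, 40], [49, 45, 47, 26, 30, 28, 46, 32,
    33, 31, 40, 48, 39], [49, 44, 27, 47, 26, 31, 28, 30, 32, 39, 41, 48], [49, 34, 24, 27, 48, 29,
    35, 33, 41, 40, 46], [49, 45, 35, 29, 48, 46, 37, 43, 44, 41], [49, 29, 37, 25, 48, 34, 46, 43,
    44], [49, 45, 36, 25, 48, 44, 46, 47], [49, 24, 36, 44, 47, 42, 43], [49, 44, 46, 45, 47, 38],
    [49, 47, 38, 45, 42], [49, 42, 38, 45], [49, 36, 37], [49, 35], [49]]"

lemma steiner_table_49: "steiner_table [24, 14, 6, 5] 49 steiner_49"
  by code_simp

text \<open>In a factor of the first color the 24 mixed edges cover all but two of the 50 new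
  points, and these two form the only edge inside a class.\<close>

lemma factor_table_49: "factor_table [24, 14, 6, 5] [24, 12, 11, 3] 49 factors_49"
  by code_simp

lemma colors_within_49: "colors_within [24, 14, 6, 5] [24, 12, 11, 3] 49"
  by code_simp

theorem corollary11:
  fixes v t w :: nat
  assumes "v \<in> {27, 39, 43, 91, 99, 103, 127, 135, 151}"
    and "t \<ge> 1"
    and "w = 2 ^ t * (v + 1) - 1"
  shows "\<exists>(V :: nat set) \<B>. steiner_triple_system w V \<B> \<and> bicolorable V \<B> \<and>
           lower_chromatic_number V \<B> \<noteq> upper_chromatic_number V \<B>"
proof -
  have s27: "two_palettes 27"
    using two_palettes_of_tables[OF steiner_table_13 factor_table_13 colors_within_13] by simp
  have s39: "two_palettes 39"
    using two_palettes_of_tables[OF steiner_table_19 factor_table_19 colors_within_19] by simp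
  have s43: "two_palettes 43"
    using two_palettes_of_tables[OF steiner_table_21 factor_table_21 colors_within_21] by simp
  have s51: "two_palettes 51"
    using two_palettes_of_tables[OF steiner_table_25 factor_table_25 colors_within_25] by simp
  have s63: "two_palettes 63"
    using two_palettes_of_tables[OF steiner_table_31 factor_table_31 colors_within_31] by simp
  have s67: "two_palettes 67"
    using two_palettes_of_tables[OF steiner_table_33 factor_table_33 colors_within_33] by simp
  have s75: "two_palettes 75"
    using two_palettes_of_tables[OF steiner_table_37 factor_table_37 colors_within_37] by simp
  have s91: "two_palettes 91"
    using two_palettes_of_tables[OF steiner_table_45 factor_table_45 colors_within_45] by simp
  have s99: "two_palettes 99"
    using two_palettes_of_tables[OF steiner_table_49 factor_table_49 colors_within_49] by simp
  \<comment> \<open>The numbers 104, 128, 136 and 152 are divisible by 4: the tables of orders 25,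
    31, 33 and 37 reach these orders in two doublings, the second of which uses the circle
    method.\<close>
  have s103: "two_palettes 103"
    using two_palettes_double[OF s51] by simp
  have s127: "two_palettes 127"
    using two_palettes_double[OF s63] by simp
  have s135: "two_palettes 135"
    using two_palettes_double[OF s67] by simp
  have s151: "two_palettes 151"
    using two_palettes_double[OF s75] by simp
  have "two_palettes v" "odd v"
    using assms(1) s27 s39 s43 s91 s99 s103 s127 s135 s151 by auto
  then have "two_palettes w"
    unfolding assms(3) by (rule two_palettes_iterate)
  then show ?thesis
    by (rule two_palettes_imp_distinct_chromatic_numbers)
qed

end
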